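(* Let $1\le p<\infty$. A set $K\subseteq L^p([0,1])$ is relatively compact (in the norm topology) if and only if $K\subseteq K^p_l$ for some $l:\mathbb{N}\to\mathbb{N}$. Moreover, there exists a second-order polynomial $P$ such that $|K^p_l|(n)\le 2^{P(l,n)}$ for all $l$ and $n$; and whenever $n\ge3$ and $l(n-3)\ge9$, it holds that $2^{l(n-3)-4}-1\le|K^p_l|(n)$.
   Context: $\tilde f$ is $f$ extended by zero to $\mathbb{R}$, $(\tau_hg)(x)=g(x+h)$. An $L^p$-modulus of $f\in L^p([0,1])$ is $\mu:\mathbb{N}\to\mathbb{N}$ with $|h|\le2^{-\mu(n)}\Rightarrow\|\tilde f-\tau_h\tilde f\|_p<2^{-n}$ for all $n\in\mathbb{N},h\in\mathbb{R}$, and $\mu(n)\ne0\Rightarrow\mu(n+1)>\mu(n)$. For $l:\mathbb{N}\to\mathbb{N}$, $K^p_l:=\{f\in L^p([0,1]): l\text{ is an }L^p\text{-modulus of }f\}$. For a subset $K$ of a metric space, its metric entropy (size) is $|K|(n):=\min\{k\in\mathbb{N}: K\text{ can be covered by }2^k\text{ balls of radius }2^{-n}\}$ (here with the $L^p$ metric). Second-order polynomials are the smallest class of maps $P:\mathbb{N}^{\mathbb{N}}\times\mathbb{N}\to\mathbb{N}$ containing $(l,n)\mapsto q(n)$ for integer polynomials $q$ and closed under $+$, $\cdot$ and $P\mapsto((l,n)\mapsto l(P(l,n)))$.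
   Formalization: The lower bound is stated only for l satisfying the growth condition l(n)≠0 ⇒ l(n+1)>l(n) from the definition of an L^p-modulus; otherwise K^p_l is empty, its entropy is 0 and the bound fails (e.g. l constantly 9, n=3). *)

theory Defs
  imports
    "HOL-Analysis.Analysis"
    "HOL-Library.Extended_Nat"
    "HOL-Computational_Algebra.Polynomial"
begin

definition Lp_norm :: "'a measure \<Rightarrow> real \<Rightarrow> ('a \<Rightarrow> real) \<Rightarrow> real" where
  "Lp_norm M p f = (\<integral>x. \<bar>f x\<bar> powr p \<partial>M) powr (1 / p)"

definition Lp_funs :: "real \<Rightarrow> (real \<Rightarrow> real) set" where
  "Lp_funs p = {f. f \<in> borel_measurable (lebesgue_on {0..1}) \<and>
                   integrable (lebesgue_on {0..1}) (\<lambda>x. \<bar>f x\<bar> powr p)}"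

definition Lp_eq :: "real \<Rightarrow> ((real \<Rightarrow> real) \<times> (real \<Rightarrow> real)) set" where
  "Lp_eq p = {(f, g). f \<in> Lp_funs p \<and> g \<in> Lp_funs p \<and>
                      (AE x in lebesgue_on {0..1}. f x = g x)}"

text \<open>\<open>L\<^sup>p([0,1])\<close> is the set of almost-everywhere equality classes. Values of a
  representative outside \<open>[0,1]\<close> are irrelevant.\<close>

definition Lp :: "real \<Rightarrow> (real \<Rightarrow> real) set set" where
  "Lp p = Lp_funs p // Lp_eq p"

definition Lp_dist :: "real \<Rightarrow> (real \<Rightarrow> real) set \<Rightarrow> (real \<Rightarrow> real) set \<Rightarrow> real" where
  "Lp_dist p F G =
     Lp_norm (lebesgue_on {0..1}) p (\<lambda>x. (SOME f. f \<in> F) x - (SOME g. g \<in> G) x)"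

definition zero_ext :: "(real \<Rightarrow> real) \<Rightarrow> real \<Rightarrow> real" where
  "zero_ext f x = (if x \<in> {0..1} then f x else 0)"

definition translate :: "real \<Rightarrow> (real \<Rightarrow> real) \<Rightarrow> real \<Rightarrow> real" where
  "translate h g x = g (x + h)"

definition modulus_growth :: "(nat \<Rightarrow> nat) \<Rightarrow> bool" where
  "modulus_growth \<mu> \<longleftrightarrow> (\<forall>n. \<mu> n \<noteq> 0 \<longrightarrow> \<mu> (n + 1) > \<mu> n)"

definition Lp_modulus :: "real \<Rightarrow> (nat \<Rightarrow> nat) \<Rightarrow> (real \<Rightarrow> real) \<Rightarrow> bool" where
  "Lp_modulus p \<mu> f \<longleftrightarrow>
     (\<forall>n h. \<bar>h\<bar> \<le> 1 / 2 ^ \<mu> n \<longrightarrow>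
        Lp_norm lebesgue p (\<lambda>x. zero_ext f x - translate h (zero_ext f) x) < 1 / 2 ^ n) \<and>
     modulus_growth \<mu>"

definition Lp_modulus_class :: "real \<Rightarrow> (nat \<Rightarrow> nat) \<Rightarrow> (real \<Rightarrow> real) set set" where
  "Lp_modulus_class p l = {F \<in> Lp p. \<forall>f\<in>F. Lp_modulus p l f}"

text \<open>Balls are open with centres anywhere in the ambient space. The infimum is a minimum
  whenever some \<open>2\<^sup>k\<close> balls suffice, and \<open>\<infinity>\<close> otherwise.\<close>

definition metric_entropy ::
    "'a set \<Rightarrow> ('a \<Rightarrow> 'a \<Rightarrow> real) \<Rightarrow> 'a set \<Rightarrow> nat \<Rightarrow> enat" where
  "metric_entropy M d K n =
     Inf {enat k |k. \<exists>c :: nat \<Rightarrow> 'a. (\<forall>i < 2 ^ k. c i \<in> M) \<and>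
            K \<subseteq> (\<Union>i < 2 ^ k. Metric_space.mball M d (c i) (1 / 2 ^ n))}"

definition relatively_compactin :: "'a topology \<Rightarrow> 'a set \<Rightarrow> bool" where
  "relatively_compactin T K \<longleftrightarrow> K \<subseteq> topspace T \<and> compactin T (T closure_of K)"

inductive second_order_poly :: "((nat \<Rightarrow> nat) \<Rightarrow> nat \<Rightarrow> nat) \<Rightarrow> bool" where
  of_poly: "(\<And>n. poly q (int n) \<ge> 0) \<Longrightarrow> second_order_poly (\<lambda>l n. nat (poly q (int n)))"
| plus: "second_order_poly P \<Longrightarrow> second_order_poly Q \<Longrightarrow>
           second_order_poly (\<lambda>l n. P l n + Q l n)"
| times: "second_order_poly P \<Longrightarrow> second_order_poly Q \<Longrightarrow>
            second_order_poly (\<lambda>l n. P l n * Q l n)"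
| appl: "second_order_poly P \<Longrightarrow> second_order_poly (\<lambda>l n. l (P l n))"

text \<open>\<open>Lp_dist\<close> is a metric and does not depend on the representatives chosen.\<close>

lemma powr_convex_nonneg:
  fixes p a b t :: real
  assumes "1 \<le> p" "0 \<le> a" "0 \<le> b" "0 \<le> t" "t \<le> 1"
  shows "((1 - t) * a + t * b) powr p \<le> (1 - t) * a powr p + t * b powr p"
proof -
  have le: "s powr p \<le> s" if "0 \<le> s" "s \<le> 1" for s :: real
    using powr_mono'[of 1 p s] assms that by (cases "s = 0") auto
  consider "a = 0" | "b = 0" | "a > 0" "b > 0"
    using assms by force
  then show ?thesis
  proof cases
    case 1
    then show ?thesis
      using assms le[of t] by (simp add: powr_mult mult_right_mono)
  next
    case 2
    then show ?thesis
      using assms le[of "1 - t"] by (simp add: powr_mult mult_right_mono)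
  next
    case 3
    then show ?thesis
      using convex_onD[OF powr_convex[OF assms(1)], of t a b] assms by simp
  qed
qed

lemma Lp_norm_nonneg: "0 \<le> Lp_norm M p f"
  by (simp add: Lp_norm_def)

lemma Lp_norm_powr:
  assumes "1 \<le> p"
  shows "Lp_norm M p f powr p = (\<integral>x. \<bar>f x\<bar> powr p \<partial>M)"
  using assms by (simp add: Lp_norm_def powr_powr)

lemma Lp_integrable_add:
  fixes f g :: "'a \<Rightarrow> real"
  assumes p: "1 \<le> p"
    and [measurable]: "f \<in> borel_measurable M" "g \<in> borel_measurable M"
    and f: "integrable M (\<lambda>x. \<bar>f x\<bar> powr p)" and g: "integrable M (\<lambda>x. \<bar>g x\<bar> powr p)"
  shows "integrable M (\<lambda>x. \<bar>f x + g x\<bar> powr p)"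
proof (rule Bochner_Integration.integrable_bound)
  show "integrable M (\<lambda>x. 2 powr p * (\<bar>f x\<bar> powr p + \<bar>g x\<bar> powr p))"
    using f g by simp
  have "\<bar>f x + g x\<bar> powr p \<le> 2 powr p * (\<bar>f x\<bar> powr p + \<bar>g x\<bar> powr p)" for x
  proof -
    have "\<bar>f x + g x\<bar> powr p \<le> (2 * max \<bar>f x\<bar> \<bar>g x\<bar>) powr p"
      using p by (intro powr_mono2) auto
    also have "\<dots> = 2 powr p * max \<bar>f x\<bar> \<bar>g x\<bar> powr p"
      by (simp add: powr_mult)
    also have "\<dots> \<le> 2 powr p * (\<bar>f x\<bar> powr p + \<bar>g x\<bar> powr p)"
      by (intro mult_left_mono) (auto simp: max_def)
    finally show ?thesis .
  qed
  then show "AE x in M. norm (\<bar>f x + g x\<bar> powr p)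
      \<le> norm (2 powr p * (\<bar>f x\<bar> powr p + \<bar>g x\<bar> powr p))"
    by (intro AE_I2) (simp add: abs_mult)
qed measurable

lemma Lp_norm_eq_0_iff:
  assumes p: "1 \<le> p" and f: "integrable M (\<lambda>x. \<bar>f x\<bar> powr p)"
  shows "Lp_norm M p f = 0 \<longleftrightarrow> (AE x in M. f x = 0)"
proof -
  have "Lp_norm M p f = 0 \<longleftrightarrow> (\<integral>x. \<bar>f x\<bar> powr p \<partial>M) = 0"
    by (simp add: Lp_norm_def)
  also have "\<dots> \<longleftrightarrow> (AE x in M. \<bar>f x\<bar> powr p = 0)"
    using f by (intro integral_nonneg_eq_0_iff_AE) auto
  finally show ?thesis by simp
qed

lemma Lp_norm_cong_AE:
  assumes "f \<in> borel_measurable M" "g \<in> borel_measurable M" "AE x in M. f x = g x"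
  shows "Lp_norm M p f = Lp_norm M p g"
proof -
  have "(\<integral>x. \<bar>f x\<bar> powr p \<partial>M) = (\<integral>x. \<bar>g x\<bar> powr p \<partial>M)"
    using assms by (intro integral_cong_AE) auto
  then show ?thesis by (simp add: Lp_norm_def)
qed

lemma Lp_norm_triangle:
  fixes f g :: "'a \<Rightarrow> real"
  assumes p: "1 \<le> p"
    and m [measurable]: "f \<in> borel_measurable M" "g \<in> borel_measurable M"
    and f: "integrable M (\<lambda>x. \<bar>f x\<bar> powr p)" and g: "integrable M (\<lambda>x. \<bar>g x\<bar> powr p)"
  shows "Lp_norm M p (\<lambda>x. f x + g x) \<le> Lp_norm M p f + Lp_norm M p g"
proof -
  define A B where "A = Lp_norm M p f" and "B = Lp_norm M p g"
  have fg: "integrable M (\<lambda>x. \<bar>f x + g x\<bar> powr p)"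
    by (rule Lp_integrable_add) fact+
  consider "A = 0" | "B = 0" | "A > 0" "B > 0"
    using Lp_norm_nonneg[of M p] A_def B_def by (metis less_eq_real_def)
  then show ?thesis
  proof cases
    case 1
    then have "AE x in M. f x = 0"
      using Lp_norm_eq_0_iff[OF p f] A_def by simp
    then have "Lp_norm M p (\<lambda>x. f x + g x) = Lp_norm M p g"
      by (intro Lp_norm_cong_AE) auto
    then show ?thesis using Lp_norm_nonneg[of M p f] by simp
  next
    case 2
    then have "AE x in M. g x = 0"
      using Lp_norm_eq_0_iff[OF p g] B_def by simp
    then have "Lp_norm M p (\<lambda>x. f x + g x) = Lp_norm M p f"
      by (intro Lp_norm_cong_AE) auto
    then show ?thesis using Lp_norm_nonneg[of M p g] by simp
  next
    case 3
    define t where "t = B / (A + B)"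
    have t: "0 \<le> t" "t \<le> 1" "1 - t = A / (A + B)"
      using 3 by (auto simp: t_def field_simps)
    have pw: "\<bar>f x + g x\<bar> powr p \<le> (A + B) powr p *
        ((1 - t) * (\<bar>f x\<bar> powr p / A powr p) + t * (\<bar>g x\<bar> powr p / B powr p))" for x
    proof -
      have "\<bar>f x + g x\<bar> powr p \<le> (\<bar>f x\<bar> + \<bar>g x\<bar>) powr p"
        using p by (intro powr_mono2) auto
      also have "\<bar>f x\<bar> + \<bar>g x\<bar> = (A + B) * ((1 - t) * (\<bar>f x\<bar> / A) + t * (\<bar>g x\<bar> / B))"
      proof -
        have "(A + B) * (1 - t) = A" "(A + B) * t = B"
          using 3 unfolding t(3) by (auto simp: t_def)
        then show ?thesis
          using 3 by (simp add: distrib_left flip: mult.assoc)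
      qed
      also have "\<dots> powr p = (A + B) powr p * ((1 - t) * (\<bar>f x\<bar> / A) + t * (\<bar>g x\<bar> / B)) powr p"
        by (simp add: powr_mult)
      also have "\<dots> \<le> (A + B) powr p *
          ((1 - t) * (\<bar>f x\<bar> / A) powr p + t * (\<bar>g x\<bar> / B) powr p)"
        using p t 3 by (intro mult_left_mono powr_convex_nonneg) auto
      finally show ?thesis using 3 by (simp add: powr_divide)
    qed
    have "(\<integral>x. \<bar>f x + g x\<bar> powr p \<partial>M) \<le> (\<integral>x. (A + B) powr p *
        ((1 - t) * (\<bar>f x\<bar> powr p / A powr p) + t * (\<bar>g x\<bar> powr p / B powr p)) \<partial>M)"
      using fg f g pw by (intro integral_mono) auto
    also have "\<dots> = (A + B) powr p * ((1 - t) * ((\<integral>x. \<bar>f x\<bar> powr p \<partial>M) / A powr p)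
        + t * ((\<integral>x. \<bar>g x\<bar> powr p \<partial>M) / B powr p))"
      using f g by simp
    also have "\<dots> = (A + B) powr p"
      using 3 by (simp add: Lp_norm_powr[OF p, symmetric] A_def[symmetric] B_def[symmetric])
    finally have "Lp_norm M p (\<lambda>x. f x + g x) \<le> ((A + B) powr p) powr (1 / p)"
      unfolding Lp_norm_def using p by (intro powr_mono2) auto
    also have "\<dots> = A + B"
      using p 3 by (simp add: powr_powr)
    finally show ?thesis by (simp add: A_def B_def)
  qed
qed

lemma equiv_Lp_eq: "equiv (Lp_funs p) (Lp_eq p)"
proof (rule equivI)
  show "Lp_eq p \<subseteq> Lp_funs p \<times> Lp_funs p"
    by (auto simp: Lp_eq_def)
  show "refl_on (Lp_funs p) (Lp_eq p)"
    by (auto simp: refl_on_def Lp_eq_def)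
  show "sym (Lp_eq p)"
    by (auto simp: sym_def Lp_eq_def elim: AE_mp)
  show "trans (Lp_eq p)"
  proof (rule transI)
    fix f g h assume "(f, g) \<in> Lp_eq p" "(g, h) \<in> Lp_eq p"
    then have "AE x in lebesgue_on {0..1}. f x = g x" "AE x in lebesgue_on {0..1}. g x = h x"
      "f \<in> Lp_funs p" "h \<in> Lp_funs p"
      by (auto simp: Lp_eq_def)
    moreover from this(1,2) have "AE x in lebesgue_on {0..1}. f x = h x"
      by eventually_elim simp
    ultimately show "(f, h) \<in> Lp_eq p"
      by (simp add: Lp_eq_def)
  qed
qed

lemma Lp_some_in:
  assumes "F \<in> Lp p"
  shows "(SOME f. f \<in> F) \<in> F"
  using in_quotient_imp_non_empty[OF equiv_Lp_eq] assms by (metis Lp_def some_in_eq)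

lemma Lp_class_subset:
  assumes "F \<in> Lp p" "f \<in> F"
  shows "f \<in> Lp_funs p"
  using in_quotient_imp_subset[OF equiv_Lp_eq] assms by (auto simp: Lp_def)

lemma Lp_funs_diff:
  assumes "1 \<le> p" "f \<in> Lp_funs p" "g \<in> Lp_funs p"
  shows "(\<lambda>x. f x - g x) \<in> Lp_funs p"
  using Lp_integrable_add[of p f "lebesgue_on {0..1}" "\<lambda>x. - g x"] assms
  by (auto simp: Lp_funs_def)

lemma Lp_dist_eq:
  assumes p: "1 \<le> p" and F: "F \<in> Lp p" "f \<in> F" and G: "G \<in> Lp p" "g \<in> G"
  shows "Lp_dist p F G = Lp_norm (lebesgue_on {0..1}) p (\<lambda>x. f x - g x)"
proof -
  let ?f = "SOME f. f \<in> F" and ?g = "SOME g. g \<in> G"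
  have "(?f, f) \<in> Lp_eq p" "(?g, g) \<in> Lp_eq p"
    using quotient_eq_iff[OF equiv_Lp_eq] F G Lp_some_in by (metis Lp_def)+
  then have ae: "AE x in lebesgue_on {0..1}. ?f x = f x" "AE x in lebesgue_on {0..1}. ?g x = g x"
    and m: "?f \<in> Lp_funs p" "f \<in> Lp_funs p" "?g \<in> Lp_funs p" "g \<in> Lp_funs p"
    by (auto simp: Lp_eq_def)
  show ?thesis
    unfolding Lp_dist_def
  proof (rule Lp_norm_cong_AE)
    show "AE x in lebesgue_on {0..1}. ?f x - ?g x = f x - g x"
      using ae by eventually_elim simp
  qed (use m in \<open>auto simp: Lp_funs_def\<close>)
qed

lemma Metric_space_Lp:
  assumes p: "1 \<le> p"
  shows "Metric_space (Lp p) (Lp_dist p)"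
proof
  show "0 \<le> Lp_dist p F G" for F G
    by (simp add: Lp_dist_def Lp_norm_nonneg)
  show "Lp_dist p F G = Lp_dist p G F" for F G
    by (simp add: Lp_dist_def Lp_norm_def abs_minus_commute)
next
  fix F G assume F: "F \<in> Lp p" and G: "G \<in> Lp p"
  let ?f = "SOME f. f \<in> F" and ?g = "SOME g. g \<in> G"
  have f: "?f \<in> F" "?f \<in> Lp_funs p" and g: "?g \<in> G" "?g \<in> Lp_funs p"
    using Lp_some_in Lp_class_subset F G by blast+
  have "integrable (lebesgue_on {0..1}) (\<lambda>x. \<bar>?f x - ?g x\<bar> powr p)"
    using Lp_funs_diff[OF p f(2) g(2)] by (simp add: Lp_funs_def)
  then have "Lp_dist p F G = 0 \<longleftrightarrow> (AE x in lebesgue_on {0..1}. ?f x - ?g x = 0)"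
    unfolding Lp_dist_def by (rule Lp_norm_eq_0_iff[OF p])
  also have "\<dots> \<longleftrightarrow> (?f, ?g) \<in> Lp_eq p"
    using f g by (simp add: Lp_eq_def)
  also have "\<dots> \<longleftrightarrow> F = G"
    using quotient_eq_iff[OF equiv_Lp_eq] F G f g by (metis Lp_def)
  finally show "Lp_dist p F G = 0 \<longleftrightarrow> F = G" .
next
  fix F G H assume F: "F \<in> Lp p" and G: "G \<in> Lp p" and H: "H \<in> Lp p"
  let ?f = "SOME f. f \<in> F" and ?g = "SOME g. g \<in> G" and ?h = "SOME h. h \<in> H"
  have "?f \<in> Lp_funs p" "?g \<in> Lp_funs p" "?h \<in> Lp_funs p"
    using Lp_some_in Lp_class_subset F G H by blast+
  then have "(\<lambda>x. ?f x - ?g x) \<in> Lp_funs p" "(\<lambda>x. ?g x - ?h x) \<in> Lp_funs p"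
    by (auto intro: Lp_funs_diff[OF p])
  then show "Lp_dist p F H \<le> Lp_dist p F G + Lp_dist p G H"
    using Lp_norm_triangle[OF p, of "\<lambda>x. ?f x - ?g x" "lebesgue_on {0..1}" "\<lambda>x. ?g x - ?h x"]
    by (simp add: Lp_dist_def Lp_funs_def)
qed

text \<open>If \<open>l\<close> violates the growth condition, it is a modulus of no function at all, and a lower
  entropy bound in terms of \<open>l\<close> fails.\<close>

lemma Lp_modulus_class_empty:
  assumes "\<not> modulus_growth l"
  shows "Lp_modulus_class p l = {}"
  using assms Lp_some_in by (auto simp: Lp_modulus_class_def Lp_modulus_def)

lemma Lp_nonempty: "Lp p \<noteq> {}"
proof -
  have "(\<lambda>x. 0) \<in> Lp_funs p"
    by (simp add: Lp_funs_def)
  then show ?thesis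
    by (auto simp: Lp_def quotient_def)
qed

lemma metric_entropy_no_growth:
  assumes "\<not> modulus_growth l"
  shows "metric_entropy (Lp p) (Lp_dist p) (Lp_modulus_class p l) n = 0"
proof -
  obtain F where "F \<in> Lp p"
    using Lp_nonempty by blast
  then have "0 \<in> {enat k |k. \<exists>c :: nat \<Rightarrow> (real \<Rightarrow> real) set. (\<forall>i < 2 ^ k. c i \<in> Lp p) \<and>
      {} \<subseteq> (\<Union>i < 2 ^ k. Metric_space.mball (Lp p) (Lp_dist p) (c i) (1 / 2 ^ n))}"
    by (auto simp: zero_enat_def intro!: exI[of _ "\<lambda>_. F"])
  then show ?thesis
    unfolding metric_entropy_def Lp_modulus_class_empty[OF assms]
    by (meson Inf_lower le_zero_eq)
qed

end

theory Submission
  imports Defs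
begin

text \<open>
  Compactness. Translation is continuous in \<open>L\<^sup>p\<close>, so finitely many functions, hence up to an arbitrary
  error all members of a totally bounded set, share a modulus. Conversely a modulus \<open>l\<close> bounds the
  norm by \<open>2\<^bsup>l(0)\<^esup>\<close>: shifting \<open>2\<^bsup>l(0)\<^esup>\<close> times by \<open>2\<^bsup>-l(0)\<^esup>\<close> moves \<open>f\<close> off its own support. By Jensen and
  Tonelli, \<open>f\<close> is within \<open>2 \<cdot> 2\<^bsup>-n-2\<^esup>\<close> of its averages over the dyadic cells of length \<open>2\<^bsup>-l(n+2)\<^esup>\<close>, and
  rounding these averages leaves finitely many step functions. Counting them gives the upper entropy
  bound; with the completeness of \<open>L\<^sup>p\<close> it gives relative compactness.

  Lower bound. With \<open>L = l(n-3)\<close> and \<open>N = 2\<^bsup>L-1\<^esup>\<close>, put a tent of width \<open>1/N\<close> and height \<open>(8/9) 2\<^bsup>3-n\<^esup>\<close> with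
  arbitrary sign on each of \<open>N\<close> cells. These \<open>2\<^sup>N\<close> functions have modulus \<open>l\<close>, and two of them in the
  same ball of radius \<open>2\<^bsup>-n\<^esup>\<close> differ in fewer than \<open>9N/32\<close> signs. A Hamming ball of that radius has at
  most \<open>2\<^bsup>7N/8\<^esup>\<close> points, so at least \<open>2\<^bsup>N/8\<^esup>\<close> balls are needed.
\<close>

section \<open>The spaces \<open>L\<^sup>p\<close> and translation\<close>

text \<open>\<open>Lp_funs\<close> is tied to the unit interval. The estimates below are also needed
  on the whole line, for \<open>lebesgue\<close> and \<open>lborel\<close>, and on single cells,
  hence an arbitrary measure.\<close>

definition Lp_space :: "'a measure \<Rightarrow> real \<Rightarrow> ('a \<Rightarrow> real) set" where
  "Lp_space M p = {f \<in> borel_measurable M. integrable M (\<lambda>x. \<bar>f x\<bar> powr p)}"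

lemma Lp_funs_eq: "Lp_funs p = Lp_space (lebesgue_on {0..1}) p"
  by (auto simp: Lp_funs_def Lp_space_def)

lemma Lp_space_measurable: "f \<in> Lp_space M p \<Longrightarrow> f \<in> borel_measurable M"
  by (simp add: Lp_space_def)

lemma Lp_space_diff:
  assumes "1 \<le> p" "f \<in> Lp_space M p" "g \<in> Lp_space M p"
  shows "(\<lambda>x. f x - g x) \<in> Lp_space M p"
  using Lp_integrable_add[of p f M "\<lambda>x. - g x"] assms by (auto simp: Lp_space_def)

lemma Lp_norm_diff_triangle:
  assumes "1 \<le> p" "f \<in> Lp_space M p" "g \<in> Lp_space M p" "h \<in> Lp_space M p"
  shows "Lp_norm M p (\<lambda>x. f x - h x)
    \<le> Lp_norm M p (\<lambda>x. f x - g x) + Lp_norm M p (\<lambda>x. g x - h x)"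
  using Lp_norm_triangle[of p "\<lambda>x. f x - g x" M "\<lambda>x. g x - h x"]
    Lp_space_diff[of p f M g] Lp_space_diff[of p g M h] assms
  by (auto simp: Lp_space_def)

lemma Lp_norm_minus_commute: "Lp_norm M p (\<lambda>x. f x - g x) = Lp_norm M p (\<lambda>x. g x - f x)"
  by (simp add: Lp_norm_def abs_minus_commute)

section \<open>Domination and norm bounds\<close>

lemma Lp_space_bound:
  assumes "g \<in> Lp_space M p" "f \<in> borel_measurable M" "AE x in M. \<bar>f x\<bar> \<le> \<bar>g x\<bar>" "0 \<le> p"
  shows "f \<in> Lp_space M p"
  unfolding Lp_space_def
proof safe
  show "integrable M (\<lambda>x. \<bar>f x\<bar> powr p)"
  proof (rule Bochner_Integration.integrable_bound)
    show "integrable M (\<lambda>x. \<bar>g x\<bar> powr p)"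
      using assms by (simp add: Lp_space_def)
    show "AE x in M. norm (\<bar>f x\<bar> powr p) \<le> norm (\<bar>g x\<bar> powr p)"
      using assms(3) by eventually_elim (use assms(4) in \<open>auto intro: powr_mono2\<close>)
  qed (use assms in measurable)
qed fact

lemma Lp_norm_mono:
  assumes "g \<in> Lp_space M p" "f \<in> borel_measurable M" "AE x in M. \<bar>f x\<bar> \<le> \<bar>g x\<bar>" "1 \<le> p"
  shows "Lp_norm M p f \<le> Lp_norm M p g"
  unfolding Lp_norm_def
proof (intro powr_mono2 integral_mono_AE)
  show "integrable M (\<lambda>x. \<bar>f x\<bar> powr p)"
    using Lp_space_bound[OF assms(1-3)] assms(4) by (auto simp: Lp_space_def)
  show "AE x in M. \<bar>f x\<bar> powr p \<le> \<bar>g x\<bar> powr p"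
    using assms(3) by eventually_elim (use assms(4) in \<open>auto intro: powr_mono2\<close>)
qed (use assms in \<open>auto simp: Lp_space_def\<close>)

lemma nn_integral_Lp_norm:
  assumes "f \<in> Lp_space M p" "1 \<le> p"
  shows "(\<integral>\<^sup>+x. ennreal (\<bar>f x\<bar> powr p) \<partial>M) = ennreal (Lp_norm M p f powr p)"
  using assms nn_integral_eq_integral[of M "\<lambda>x. \<bar>f x\<bar> powr p"]
  by (simp add: Lp_space_def Lp_norm_powr)

text \<open>The Bochner integral in \<open>Lp_norm\<close> is 0 for a non-integrable function, so a
  small norm alone proves nothing. A bound on the nonnegative integral gives integrability and the
  norm bound together.\<close>

lemma Lp_norm_leI:
  assumes "f \<in> borel_measurable M" "(\<integral>\<^sup>+x. ennreal (\<bar>f x\<bar> powr p) \<partial>M) \<le> ennreal (c powr p)"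
    "0 \<le> c" "1 \<le> p"
  shows "f \<in> Lp_space M p" "Lp_norm M p f \<le> c"
proof -
  have "integrable M (\<lambda>x. \<bar>f x\<bar> powr p)"
    using assms by (intro integrableI_nonneg) (auto simp: order_le_less_trans)
  then show f: "f \<in> Lp_space M p"
    using assms by (auto simp: Lp_space_def)
  from nn_integral_Lp_norm[OF this] assms have "Lp_norm M p f powr p \<le> c powr p"
    by simp
  then show "Lp_norm M p f \<le> c"
    using assms by (meson Lp_norm_nonneg not_le powr_less_mono2 order_less_le_trans zero_less_one)
qed

lemma Lp_norm_bounded_support:
  assumes "f \<in> borel_measurable M" "A \<in> sets M" "emeasure M A \<le> ennreal m"
    "\<And>x. x \<in> space M \<Longrightarrow> x \<notin> A \<Longrightarrow> f x = 0" "\<And>x. \<bar>f x\<bar> \<le> c" "0 \<le> c" "0 \<le> m" "1 \<le> p"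
  shows "f \<in> Lp_space M p" "Lp_norm M p f \<le> c * m powr (1 / p)"
proof -
  have "(\<integral>\<^sup>+x. ennreal (\<bar>f x\<bar> powr p) \<partial>M) \<le> (\<integral>\<^sup>+x. ennreal (c powr p) * indicator A x \<partial>M)"
    using assms by (intro nn_integral_mono) (auto simp: indicator_def intro!: ennreal_leI powr_mono2)
  also have "\<dots> = ennreal (c powr p) * emeasure M A"
    using assms by (intro nn_integral_cmult_indicator)
  also have "\<dots> \<le> ennreal (c powr p) * ennreal m"
    using assms by (intro mult_left_mono) auto
  also have "\<dots> = ennreal ((c * m powr (1 / p)) powr p)"
    using assms by (simp add: powr_mult powr_powr flip: ennreal_mult)
  finally have *: "(\<integral>\<^sup>+x. ennreal (\<bar>f x\<bar> powr p) \<partial>M) \<le> ennreal ((c * m powr (1 / p)) powr p)" .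
  show "f \<in> Lp_space M p" "Lp_norm M p f \<le> c * m powr (1 / p)"
    using Lp_norm_leI[OF assms(1) *] assms by auto
qed

text \<open>The tangent of t^p at t = 1 lies below the graph. Taking t = |u| / A, with A the mean of
  |u|, the linear term integrates to zero. The total mass m is left free so that the result applies
  to cells of length 1 / M without rescaling.\<close>

lemma Jensen_powr:
  assumes p: "1 \<le> p" and "finite_measure M" and m: "measure M (space M) = m" "0 < m"
    and u: "u \<in> Lp_space M p"
  shows "integrable M u" "(\<bar>\<integral>x. u x \<partial>M\<bar> / m) powr p \<le> (\<integral>x. \<bar>u x\<bar> powr p \<partial>M) / m"
proof -
  interpret finite_measure M by fact
  have [measurable]: "u \<in> borel_measurable M" and up: "integrable M (\<lambda>x. \<bar>u x\<bar> powr p)"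
    using u by (auto simp: Lp_space_def)
  have tangent: "1 + p * (t - 1) \<le> t powr p" if "0 \<le> t" for t :: real
  proof (cases "t = 0")
    case False
    \<comment> \<open>Young's inequality for t^p and 1 with weights 1 / p and 1 - 1 / p.\<close>
    have "(t powr p) powr (1 / p) * 1 powr (1 - 1 / p) \<le> (1 / p) * t powr p + (1 - 1 / p) * 1"
      using p that False by (intro Youngs_inequality_0) auto
    then have "t \<le> t powr p / p + 1 - 1 / p"
      using p that by (simp add: powr_powr)
    then have "p * t \<le> p * (t powr p / p + 1 - 1 / p)"
      using p by (intro mult_left_mono) auto
    also have "\<dots> = t powr p + p - 1"
      using p by (simp add: field_simps)
    finally show ?thesis
      by (simp add: algebra_simps)
  qed (use p in simp)
  show ui: "integrable M u"
  proof (rule Bochner_Integration.integrable_bound)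
    show "integrable M (\<lambda>x. \<bar>u x\<bar> powr p + 1)"
      using up by simp
    have "\<bar>u x\<bar> \<le> \<bar>u x\<bar> powr p + 1" for x
    proof (cases "\<bar>u x\<bar> \<le> 1")
      case False
      then show ?thesis using powr_mono[of 1 p "\<bar>u x\<bar>"] p by simp
    qed (simp add: add_increasing)
    then show "AE x in M. norm (u x) \<le> norm (\<bar>u x\<bar> powr p + 1)"
      by (intro AE_I2) (simp add: abs_of_nonneg)
  qed measurable
  define A where "A = (\<integral>x. \<bar>u x\<bar> \<partial>M) / m"
  have A0: "0 \<le> A"
    using m by (simp add: A_def)
  have "A powr p \<le> (\<integral>x. \<bar>u x\<bar> powr p \<partial>M) / m"
  proof (cases "A = 0")
    case False
    with A0 have A: "A > 0" by simp
    have *: "A powr p * (1 + p * (\<bar>u x\<bar> / A - 1)) \<le> \<bar>u x\<bar> powr p" for x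
    proof -
      have "A powr p * (1 + p * (\<bar>u x\<bar> / A - 1)) \<le> A powr p * (\<bar>u x\<bar> / A) powr p"
        using A by (intro mult_left_mono tangent) auto
      also have "\<dots> = \<bar>u x\<bar> powr p"
        using A by (simp add: powr_divide)
      finally show ?thesis .
    qed
    have "(\<integral>x. A powr p * (1 + p * (\<bar>u x\<bar> / A - 1)) \<partial>M) \<le> (\<integral>x. \<bar>u x\<bar> powr p \<partial>M)"
      using ui up * by (intro integral_mono) auto
    also have "(\<integral>x. A powr p * (1 + p * (\<bar>u x\<bar> / A - 1)) \<partial>M)
        = A powr p * (m + p * ((\<integral>x. \<bar>u x\<bar> \<partial>M) / A - m))"
      using ui m by simp
    also have "(\<integral>x. \<bar>u x\<bar> \<partial>M) / A = m"
      using A m by (simp add: A_def field_simps)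
    finally show ?thesis
      using m by (simp add: field_simps)
  qed (use p m in simp)
  moreover have "(\<bar>\<integral>x. u x \<partial>M\<bar> / m) powr p \<le> A powr p"
    using m p integral_abs_bound[of M u] unfolding A_def by (intro powr_mono2 divide_right_mono) auto
  ultimately show "(\<bar>\<integral>x. u x \<partial>M\<bar> / m) powr p \<le> (\<integral>x. \<bar>u x\<bar> powr p \<partial>M) / m"
    by linarith
qed

text \<open>Jensen on a probability space. It serves twice: L^1 increments give almost everywhere
  convergence in the completeness proof, and the L^1 distance of two tent functions can be computed
  exactly.\<close>

lemma L1_le_Lp_norm:
  assumes p: "1 \<le> p" and u: "u \<in> Lp_space (lebesgue_on {0..1::real}) p"
  shows "integrable (lebesgue_on {0..1}) u"
    "(\<integral>x. \<bar>u x\<bar> \<partial>lebesgue_on {0..1}) \<le> Lp_norm (lebesgue_on {0..1}) p u"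
proof -
  let ?M = "lebesgue_on {0..1::real}"
  have M: "finite_measure ?M" "measure ?M (space ?M) = 1"
    by (auto simp: finite_measure_lebesgue_on measure_restrict_space)
  show "integrable ?M u"
    using Jensen_powr[OF p M _ u] by simp
  have "(\<lambda>x. \<bar>u x\<bar>) \<in> Lp_space ?M p"
    using u by (auto simp: Lp_space_def)
  from Jensen_powr(2)[OF p M _ this]
  have "(\<integral>x. \<bar>u x\<bar> \<partial>?M) powr p \<le> Lp_norm ?M p u powr p"
    by (simp add: Lp_norm_powr[OF p])
  then show "(\<integral>x. \<bar>u x\<bar> \<partial>?M) \<le> Lp_norm ?M p u"
    using p by (meson Lp_norm_nonneg not_le powr_less_mono2 order_less_le_trans zero_less_one)
qed

section \<open>Extension by zero and translation invariance\<close>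

lemma zero_ext_measurable:
  "f \<in> borel_measurable (lebesgue_on {0..1}) \<Longrightarrow> zero_ext f \<in> borel_measurable lebesgue"
  unfolding zero_ext_def[abs_def]
  by (subst borel_measurable_if) auto

lemma zero_ext_indicator:
  "1 \<le> p \<Longrightarrow> \<bar>zero_ext f x\<bar> powr p = indicator {0..1} x *\<^sub>R (\<bar>f x\<bar> powr p)"
  by (simp add: zero_ext_def)

lemma zero_ext_Lp_space:
  assumes "1 \<le> p" "f \<in> Lp_funs p"
  shows "zero_ext f \<in> Lp_space lebesgue p"
  using assms integrable_restrict_space[of "{0..1}" lebesgue "\<lambda>x. \<bar>f x\<bar> powr p"]
  unfolding Lp_space_def Lp_funs_def
  by (auto simp: zero_ext_measurable zero_ext_indicator)

lemma Lp_norm_zero_ext: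
  assumes "1 \<le> p"
  shows "Lp_norm lebesgue p (zero_ext f) = Lp_norm (lebesgue_on {0..1}) p f"
  using assms integral_restrict_space[of "{0..1}" lebesgue "\<lambda>x. \<bar>f x\<bar> powr p"]
  by (simp add: Lp_norm_def zero_ext_indicator)

lemma zero_ext_diff: "zero_ext (\<lambda>x. f x - g x) = (\<lambda>x. zero_ext f x - zero_ext g x)"
  by (auto simp: zero_ext_def)

lemma AE_zero_ext:
  assumes "AE x in lebesgue_on {0..1}. f x = g x"
  shows "AE x in lebesgue. zero_ext f x = zero_ext g x"
  using assms by (auto simp: AE_restrict_space_iff zero_ext_def elim: AE_mp)

lemma lebesgue_translation_measurable [measurable]: "(\<lambda>x::real. x + h) \<in> lebesgue \<rightarrow>\<^sub>M lebesgue"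
  using lebesgue_affine_measurable[where c = "\<lambda>_::real. 1" and t = h] by (simp add: add.commute)

lemma lebesgue_distr_translation: "distr lebesgue lebesgue (\<lambda>x::real. x + h) = lebesgue"
  using lebesgue_real_affine[of 1 h] by (simp add: density_1 add.commute)

lemma AE_translate:
  fixes h :: real
  assumes "AE x in lebesgue. P x"
  shows "AE x in lebesgue. P (x + h)"
proof -
  obtain N where N: "\<And>x. x \<in> space lebesgue - N \<Longrightarrow> P x" "N \<in> null_sets lebesgue"
    using AE_E3[OF assms] by blast
  have "emeasure lebesgue ((\<lambda>x. x + h) -` N) = emeasure (distr lebesgue lebesgue (\<lambda>x::real. x + h)) N"
    using N(2) by (subst emeasure_distr) auto
  then have "(\<lambda>x. x + h) -` N \<in> null_sets lebesgue"
    using N(2) measurable_sets[OF lebesgue_translation_measurable, of N h]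
    by (auto simp: lebesgue_distr_translation null_sets_def)
  then show ?thesis
    by (rule AE_I') (use N in auto)
qed

lemma translate_Lp_space:
  assumes "f \<in> Lp_space lebesgue p"
  shows "translate h f \<in> Lp_space lebesgue p"
proof -
  have [measurable]: "f \<in> borel_measurable lebesgue"
    using assms by (rule Lp_space_measurable)
  have "integrable (distr lebesgue lebesgue (\<lambda>x::real. x + h)) (\<lambda>x. \<bar>f x\<bar> powr p)"
    using assms unfolding lebesgue_distr_translation by (simp add: Lp_space_def)
  then have "integrable lebesgue (\<lambda>x. \<bar>f (x + h)\<bar> powr p)"
    by (subst (asm) integrable_distr_eq) auto
  then show ?thesis
    by (auto simp: Lp_space_def translate_def[abs_def])
qed

lemma Lp_norm_translate:
  assumes [measurable]: "f \<in> borel_measurable lebesgue"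
  shows "Lp_norm lebesgue p (translate h f) = Lp_norm lebesgue p f"
proof -
  have "(\<integral>x. \<bar>f x\<bar> powr p \<partial>distr lebesgue lebesgue (\<lambda>x::real. x + h))
      = (\<integral>x. \<bar>f (x + h)\<bar> powr p \<partial>lebesgue)"
    by (subst integral_distr) auto
  then show ?thesis
    by (simp add: Lp_norm_def translate_def lebesgue_distr_translation)
qed

text \<open>Representatives differ on a null set, and the translate of this null set is null as
  well. Hence the modulus condition depends only on the class.\<close>

lemma Lp_norm_shift_cong_AE:
  assumes "1 \<le> p" "(f, g) \<in> Lp_eq p"
  shows "Lp_norm lebesgue p (\<lambda>x. zero_ext f x - translate h (zero_ext f) x)
       = Lp_norm lebesgue p (\<lambda>x. zero_ext g x - translate h (zero_ext g) x)"
proof (rule Lp_norm_cong_AE)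
  have fg: "f \<in> Lp_funs p" "g \<in> Lp_funs p" "AE x in lebesgue_on {0..1}. f x = g x"
    using assms by (auto simp: Lp_eq_def)
  have "AE x in lebesgue. zero_ext f x = zero_ext g x"
    using AE_zero_ext[OF fg(3)] .
  moreover have "AE x in lebesgue. zero_ext f (x + h) = zero_ext g (x + h)"
    using AE_translate[OF AE_zero_ext[OF fg(3)]] .
  ultimately show "AE x in lebesgue. zero_ext f x - translate h (zero_ext f) x
      = zero_ext g x - translate h (zero_ext g) x"
    by eventually_elim (simp add: translate_def)
  show "(\<lambda>x. zero_ext f x - translate h (zero_ext f) x) \<in> borel_measurable lebesgue"
    "(\<lambda>x. zero_ext g x - translate h (zero_ext g) x) \<in> borel_measurable lebesgue"
    using fg assms(1)
    by (auto intro!: Lp_space_measurable Lp_space_diff translate_Lp_space zero_ext_Lp_space)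
qed

lemma Lp_modulus_cong:
  assumes "1 \<le> p" "(f, g) \<in> Lp_eq p"
  shows "Lp_modulus p l f \<longleftrightarrow> Lp_modulus p l g"
  using Lp_norm_shift_cong_AE[OF assms] by (simp add: Lp_modulus_def)

lemma Lp_class:
  assumes "f \<in> Lp_funs p"
  shows "Lp_eq p `` {f} \<in> Lp p" "f \<in> Lp_eq p `` {f}"
  using assms equiv_class_self[OF equiv_Lp_eq] by (auto simp: Lp_def quotient_def)

lemma Lp_same_class:
  assumes "F \<in> Lp p" "f \<in> F" "g \<in> F"
  shows "(f, g) \<in> Lp_eq p"
  using quotient_eq_iff[OF equiv_Lp_eq] assms by (metis Lp_def)

text \<open>The class \<open>Lp_modulus_class\<close> quantifies over all representatives; this lets
  one explicit representative, such as a tent function, decide membership.\<close>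

lemma Lp_modulus_class_iff:
  assumes "1 \<le> p" "F \<in> Lp p" "f \<in> F"
  shows "F \<in> Lp_modulus_class p l \<longleftrightarrow> Lp_modulus p l f"
  unfolding Lp_modulus_class_def
  using Lp_modulus_cong[OF assms(1) Lp_same_class[OF assms(2,3)]] assms by blast

section \<open>Completeness and continuity of translation\<close>

text \<open>The Riesz-Fischer argument: a subsequence with distances below 2^-k converges almost
  everywhere, Fatou's lemma turns this into convergence in norm, and a Cauchy sequence with a
  convergent subsequence converges.\<close>

lemma mcomplete_Lp:
  assumes p: "1 \<le> p"
  shows "Metric_space.mcomplete (Lp p) (Lp_dist p)"
proof -
  interpret Metric_space "Lp p" "Lp_dist p"
    by (rule Metric_space_Lp[OF p])
  let ?M = "lebesgue_on {0..1::real}"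
  have "\<exists>W. limitin mtopology \<sigma> W sequentially" if C: "MCauchy \<sigma>" for \<sigma>
  proof -
    have \<sigma>: "\<sigma> k \<in> Lp p" for k
      using C by (auto simp: MCauchy_def)
    define u where "u k = (SOME f. f \<in> \<sigma> k)" for k
    have u: "u k \<in> \<sigma> k" "u k \<in> Lp_funs p" for k
      using Lp_some_in[OF \<sigma>] Lp_class_subset[OF \<sigma>] by (auto simp: u_def)
    have "\<exists>N. \<forall>i j. N \<le> i \<longrightarrow> N \<le> j \<longrightarrow> Lp_dist p (\<sigma> i) (\<sigma> j) < (1 / 2) ^ k" for k :: nat
      using C by (simp add: MCauchy_def)
    then obtain N where N: "\<And>k i j. N k \<le> i \<Longrightarrow> N k \<le> j \<Longrightarrow> Lp_dist p (\<sigma> i) (\<sigma> j) < (1 / 2) ^ k"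
      by metis
    \<comment> \<open>Partial sums of \<open>N i + 1\<close> make \<open>r\<close> strictly
      increasing and keep it above \<open>N\<close>.\<close>
    define r where "r k = (\<Sum>i\<le>k. N i + 1)" for k
    have r: "strict_mono r"
      by (simp add: strict_mono_Suc_iff r_def)
    have rN: "N k \<le> r k" for k
      by (cases k) (auto simp: r_def)
    define v where "v k = u (r k)" for k
    have v: "v k \<in> Lp_space ?M p" for k
      using u by (simp add: v_def Lp_funs_eq)
    then have [measurable]: "v k \<in> borel_measurable ?M" for k
      by (rule Lp_space_measurable)
    have vd: "Lp_norm ?M p (\<lambda>x. v i x - v j x) < (1 / 2) ^ k" if "k \<le> i" "k \<le> j" for i j k
    proof -
      have "r k \<le> r i" "r k \<le> r j"
        using that r by (auto simp: strict_mono_less_eq)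
      then have "Lp_dist p (\<sigma> (r i)) (\<sigma> (r j)) < (1 / 2) ^ k"
        using rN[of k] by (intro N) auto
      then show ?thesis
        using Lp_dist_eq[OF p \<sigma> u(1) \<sigma> u(1)] by (simp add: v_def)
    qed
    have vk: "(\<integral>\<^sup>+x. ennreal \<bar>v (Suc k) x - v k x\<bar> \<partial>?M) \<le> ennreal ((1 / 2) ^ k)" for k
    proof -
      have d: "(\<lambda>x. v (Suc k) x - v k x) \<in> Lp_space ?M p"
        using v p by (intro Lp_space_diff) auto
      have "(\<integral>\<^sup>+x. ennreal \<bar>v (Suc k) x - v k x\<bar> \<partial>?M) = ennreal (\<integral>x. \<bar>v (Suc k) x - v k x\<bar> \<partial>?M)"
        using L1_le_Lp_norm(1)[OF p d] by (intro nn_integral_eq_integral) auto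
      also have "\<dots> \<le> ennreal ((1 / 2) ^ k)"
        using L1_le_Lp_norm(2)[OF p d] vd[of k "Suc k" k] by (intro ennreal_leI) auto
      finally show ?thesis .
    qed
    have "(\<integral>\<^sup>+x. (\<Sum>k. ennreal \<bar>v (Suc k) x - v k x\<bar>) \<partial>?M)
        = (\<Sum>k. \<integral>\<^sup>+x. ennreal \<bar>v (Suc k) x - v k x\<bar> \<partial>?M)"
      by (intro nn_integral_suminf) measurable
    also have "\<dots> \<le> (\<Sum>k. ennreal ((1 / 2) ^ k))"
      using vk by (intro suminf_le) auto
    also have "\<dots> < \<infinity>"
      by (subst suminf_ennreal2) (auto intro: summable_geometric)
    \<comment> \<open>The L^1 norms of the increments are at most 2^-k, so the telescoping series
      converges absolutely almost everywhere.\<close>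
    finally have "AE x in ?M. (\<Sum>k. ennreal \<bar>v (Suc k) x - v k x\<bar>) \<noteq> \<infinity>"
      by (intro nn_integral_noteq_infinite) auto
    then have conv: "AE x in ?M. convergent (\<lambda>k. v k x)"
    proof eventually_elim
      case (elim x)
      then have "summable (\<lambda>k. \<bar>v (Suc k) x - v k x\<bar>)"
        by (intro summable_suminf_not_top) auto
      then have "summable (\<lambda>k. v (Suc k) x - v k x)"
        by (rule summable_rabs_cancel)
      then have "convergent (\<lambda>n. \<Sum>k<n. v (Suc k) x - v k x)"
        by (simp add: summable_iff_convergent)
      then have "convergent (\<lambda>n. v n x - v 0 x)"
        by (simp add: sum_lessThan_telescope[of "\<lambda>k. v k x"])
      then show ?case
        using convergent_diff_const_right_iff by blast
    qed
    \<comment> \<open>Where the sequence diverges, \<open>lim\<close> is an unspecified value; this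
      happens only on a null set.\<close>
    define w where "w x = lim (\<lambda>k. v k x)" for x
    have [measurable]: "w \<in> borel_measurable ?M"
      unfolding w_def[abs_def] by (rule borel_measurable_lim_metric) measurable
    have vw: "(\<lambda>x. v k x - w x) \<in> Lp_space ?M p" "Lp_norm ?M p (\<lambda>x. v k x - w x) \<le> (1 / 2) ^ k" for k
    proof -
      have "(\<integral>\<^sup>+x. ennreal (\<bar>v k x - w x\<bar> powr p) \<partial>?M)
          = (\<integral>\<^sup>+x. liminf (\<lambda>j. ennreal (\<bar>v k x - v j x\<bar> powr p)) \<partial>?M)"
      proof (rule nn_integral_cong_AE)
        show "AE x in ?M. ennreal (\<bar>v k x - w x\<bar> powr p)
            = liminf (\<lambda>j. ennreal (\<bar>v k x - v j x\<bar> powr p))"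
          using conv
        proof eventually_elim
          case (elim x)
          then have "(\<lambda>j. v j x) \<longlonglongrightarrow> w x"
            by (simp add: w_def convergent_LIMSEQ_iff)
          then have "(\<lambda>j. ennreal (\<bar>v k x - v j x\<bar> powr p)) \<longlonglongrightarrow> ennreal (\<bar>v k x - w x\<bar> powr p)"
            using p by (intro tendsto_ennrealI tendsto_powr' tendsto_intros) auto
          from lim_imp_Liminf[OF _ this] show ?case
            by simp
        qed
      qed
      \<comment> \<open>Fatou's lemma in the second index, with k fixed.\<close>
      also have "\<dots> \<le> liminf (\<lambda>j. \<integral>\<^sup>+x. ennreal (\<bar>v k x - v j x\<bar> powr p) \<partial>?M)"
        by (intro nn_integral_liminf) measurable
      also have "\<dots> \<le> ennreal (((1 / 2) ^ k) powr p)"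
      proof (rule Liminf_le)
        show "\<forall>\<^sub>F j in sequentially. (\<integral>\<^sup>+x. ennreal (\<bar>v k x - v j x\<bar> powr p) \<partial>?M)
            \<le> ennreal (((1 / 2) ^ k) powr p)"
          using eventually_ge_at_top[of k]
        proof eventually_elim
          case (elim j)
          have "(\<integral>\<^sup>+x. ennreal (\<bar>v k x - v j x\<bar> powr p) \<partial>?M)
              = ennreal (Lp_norm ?M p (\<lambda>x. v k x - v j x) powr p)"
            using v p by (intro nn_integral_Lp_norm Lp_space_diff) auto
          also have "\<dots> \<le> ennreal (((1 / 2) ^ k) powr p)"
            using vd[of k k j] elim p by (intro ennreal_leI powr_mono2) (auto simp: Lp_norm_nonneg)
          finally show ?case .
        qed
      qed simp
      finally have *: "(\<integral>\<^sup>+x. ennreal (\<bar>v k x - w x\<bar> powr p) \<partial>?M) \<le> ennreal (((1 / 2) ^ k) powr p)" .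
      show "(\<lambda>x. v k x - w x) \<in> Lp_space ?M p" "Lp_norm ?M p (\<lambda>x. v k x - w x) \<le> (1 / 2) ^ k"
        using Lp_norm_leI[OF _ *] p by auto
    qed
    have "w \<in> Lp_funs p"
      using Lp_space_diff[OF p v[of 0] vw(1)[of 0]] by (simp add: Lp_funs_eq)
    note W = Lp_class[OF this]
    have "limitin mtopology (\<sigma> \<circ> r) (Lp_eq p `` {w}) sequentially"
      unfolding limitin_metric
    proof (intro conjI allI impI)
      fix e :: real assume "0 < e"
      have "(\<lambda>k. (1 / 2 :: real) ^ k) \<longlonglongrightarrow> 0"
        by (intro LIMSEQ_power_zero) auto
      then have "\<forall>\<^sub>F k in sequentially. (1 / 2 :: real) ^ k < e"
        using \<open>0 < e\<close> by (rule order_tendstoD)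
      then show "\<forall>\<^sub>F k in sequentially. (\<sigma> \<circ> r) k \<in> Lp p \<and> Lp_dist p ((\<sigma> \<circ> r) k) (Lp_eq p `` {w}) < e"
      proof eventually_elim
        case (elim k)
        then show ?case
          using vw(2)[of k] \<sigma> Lp_dist_eq[OF p \<sigma> u(1) W, of "r k"] by (simp add: v_def)
      qed
    qed (rule W)
    then show ?thesis
      using MCauchy_convergent_subsequence[OF C r] by blast
  qed
  then show ?thesis
    by (simp add: mcomplete_def)
qed

section \<open>Continuity of translation in the L^p norm\<close>

lemma Lp_norm_dominated_convergence:
  assumes p: "1 \<le> p" and [measurable]: "\<And>k. w k \<in> borel_measurable M" and G: "G \<in> Lp_space M p"
    and lim: "AE x in M. (\<lambda>k. w k x) \<longlonglongrightarrow> 0" and le: "\<And>k. AE x in M. \<bar>w k x\<bar> \<le> \<bar>G x\<bar>"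
  shows "(\<lambda>k. Lp_norm M p (w k)) \<longlonglongrightarrow> 0"
proof -
  have "(\<lambda>k. \<integral>x. \<bar>w k x\<bar> powr p \<partial>M) \<longlonglongrightarrow> (\<integral>x. 0 \<partial>M)"
  proof (rule integral_dominated_convergence)
    show "integrable M (\<lambda>x. \<bar>G x\<bar> powr p)"
      using G by (simp add: Lp_space_def)
    show "AE x in M. (\<lambda>k. \<bar>w k x\<bar> powr p) \<longlonglongrightarrow> 0"
      using lim by eventually_elim
        (use p in \<open>auto intro!: tendsto_zero_powrI tendsto_rabs_zero\<close>)
    show "AE x in M. norm (\<bar>w k x\<bar> powr p) \<le> \<bar>G x\<bar> powr p" for k
      using le[of k] by eventually_elim (use p in \<open>auto intro: powr_mono2\<close>)
  qed auto
  then show ?thesis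
    unfolding Lp_norm_def using p by (intro tendsto_zero_powrI) (auto intro!: always_eventually)
qed

text \<open>Continuity of translation at h = 0, stated for functions on the whole line because the
  approximants used below are not supported in [0,1].\<close>

definition shift_continuous :: "real \<Rightarrow> (real \<Rightarrow> real) \<Rightarrow> bool" where
  "shift_continuous p f \<longleftrightarrow> (\<forall>e>0. \<exists>\<delta>>0. \<forall>h. \<bar>h\<bar> \<le> \<delta> \<longrightarrow>
     Lp_norm lebesgue p (\<lambda>x. f x - translate h f x) < e)"

text \<open>The error f - g is paid twice, once as it stands and once translated, and translation
  preserves the norm. The case g = 0 gives the crude bound by twice the norm of f.\<close>

lemma Lp_norm_shift_le:
  assumes p: "1 \<le> p" and f: "f \<in> Lp_space lebesgue p" and g: "g \<in> Lp_space lebesgue p"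
  shows "Lp_norm lebesgue p (\<lambda>x. f x - translate h f x)
    \<le> 2 * Lp_norm lebesgue p (\<lambda>x. f x - g x) + Lp_norm lebesgue p (\<lambda>x. g x - translate h g x)"
proof -
  have fg: "(\<lambda>x. g x - f x) \<in> borel_measurable lebesgue"
    using p f g by (intro Lp_space_measurable Lp_space_diff)
  have "Lp_norm lebesgue p (\<lambda>x. translate h g x - translate h f x) = Lp_norm lebesgue p (\<lambda>x. f x - g x)"
    using Lp_norm_translate[OF fg, of p h] Lp_norm_minus_commute[of lebesgue p f g]
    by (simp add: translate_def[abs_def])
  moreover have "Lp_norm lebesgue p (\<lambda>x. g x - translate h f x)
      \<le> Lp_norm lebesgue p (\<lambda>x. g x - translate h g x)
        + Lp_norm lebesgue p (\<lambda>x. translate h g x - translate h f x)"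
    using p f g by (intro Lp_norm_diff_triangle translate_Lp_space)
  moreover have "Lp_norm lebesgue p (\<lambda>x. f x - translate h f x)
      \<le> Lp_norm lebesgue p (\<lambda>x. f x - g x) + Lp_norm lebesgue p (\<lambda>x. g x - translate h f x)"
    using p f g by (intro Lp_norm_diff_triangle translate_Lp_space)
  ultimately show ?thesis by linarith
qed

text \<open>Allows the reduction from a general function to its truncations and from these to
  continuous functions of compact support.\<close>

lemma shift_continuous_limit:
  assumes p: "1 \<le> p" and f: "f \<in> Lp_space lebesgue p"
    and g: "\<And>k. g k \<in> Lp_space lebesgue p" "\<And>k. shift_continuous p (g k)"
    and lim: "(\<lambda>k. Lp_norm lebesgue p (\<lambda>x. f x - g k x)) \<longlonglongrightarrow> 0"
  shows "shift_continuous p f"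
  unfolding shift_continuous_def
proof (intro allI impI)
  fix e :: real assume e: "0 < e"
  then have "\<forall>\<^sub>F k in sequentially. Lp_norm lebesgue p (\<lambda>x. f x - g k x) < e / 4"
    using lim by (intro order_tendstoD) auto
  then obtain k where k: "Lp_norm lebesgue p (\<lambda>x. f x - g k x) < e / 4"
    by (auto dest: eventually_happens)
  obtain \<delta> where "\<delta> > 0"
    "\<forall>h. \<bar>h\<bar> \<le> \<delta> \<longrightarrow> Lp_norm lebesgue p (\<lambda>x. g k x - translate h (g k) x) < e / 2"
    using g(2)[of k] e unfolding shift_continuous_def by (meson half_gt_zero)
  moreover have "Lp_norm lebesgue p (\<lambda>x. f x - translate h f x) < e"
    if "Lp_norm lebesgue p (\<lambda>x. g k x - translate h (g k) x) < e / 2" for h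
    using Lp_norm_shift_le[OF p f g(1)[of k], of h] k that by linarith
  ultimately show "\<exists>\<delta>>0. \<forall>h. \<bar>h\<bar> \<le> \<delta> \<longrightarrow> Lp_norm lebesgue p (\<lambda>x. f x - translate h f x) < e"
    by blast
qed

text \<open>A failure yields shifts \<open>h k\<close> tending to 0 along which the norm stays at
  least e. Continuity gives pointwise convergence and, as |h k| \<le> 1, everything lives on [-2,3]
  under the bound 2 B, so dominated convergence contradicts this.\<close>

lemma shift_continuous_compact_support:
  assumes p: "1 \<le> p" and g: "continuous_on UNIV g" "\<And>x. x \<notin> {-1..2} \<Longrightarrow> g x = 0" "\<And>x. \<bar>g x\<bar> \<le> B"
  shows "shift_continuous p g"
proof (rule ccontr)
  assume "\<not> shift_continuous p g"
  then obtain e where e: "e > 0"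
    and "\<forall>\<delta>>0. \<exists>h. \<bar>h\<bar> \<le> \<delta> \<and> \<not> Lp_norm lebesgue p (\<lambda>x. g x - translate h g x) < e"
    by (auto simp: shift_continuous_def)
  then have "\<exists>h. \<bar>h\<bar> \<le> 1 / real (Suc k) \<and> \<not> Lp_norm lebesgue p (\<lambda>x. g x - translate h g x) < e" for k
    by simp
  then obtain h where h: "\<And>k. \<bar>h k\<bar> \<le> 1 / real (Suc k)"
    "\<And>k. \<not> Lp_norm lebesgue p (\<lambda>x. g x - translate (h k) g x) < e"
    by metis
  have h0: "h \<longlonglongrightarrow> 0"
    by (rule tendsto_0_le[OF lim_inverse_n'[THEN LIMSEQ_Suc], of _ 1]) (use h(1) in \<open>auto intro!: always_eventually\<close>)
  have h1: "\<bar>h k\<bar> \<le> 1" for k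
    using h(1)[of k] by (simp add: order_trans)
  have [measurable]: "g \<in> borel_measurable lebesgue"
    using borel_measurable_continuous_onI[OF g(1)] by (auto intro: measurable_completion)
  have B: "0 \<le> B"
    using g(3)[of 0] by linarith
  have "(\<lambda>k. Lp_norm lebesgue p (\<lambda>x. g x - translate (h k) g x)) \<longlonglongrightarrow> 0"
  proof (rule Lp_norm_dominated_convergence[OF p, where G = "\<lambda>x. 2 * B * indicator {-2..3::real} x"])
    show "(\<lambda>x. 2 * B * indicator {-2..3::real} x) \<in> Lp_space lebesgue p"
      by (rule Lp_norm_bounded_support[where A = "{-2..3}" and m = 5 and c = "2 * B"])
        (use p B in \<open>auto split: split_indicator intro!: borel_measurable_times borel_measurable_indicator\<close>)
    show "(\<lambda>x. g x - translate (h k) g x) \<in> borel_measurable lebesgue" for k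
      unfolding translate_def by measurable
    show "AE x in lebesgue. (\<lambda>k. g x - translate (h k) g x) \<longlonglongrightarrow> 0"
    proof (rule AE_I2)
      fix x
      have "(\<lambda>k. x + h k) \<longlonglongrightarrow> x"
        using tendsto_add[OF tendsto_const[of x] h0] by simp
      then have "(\<lambda>k. g (x + h k)) \<longlonglongrightarrow> g x"
        using g(1) by (intro isCont_tendsto_compose[of x g]) (auto simp: continuous_on_eq_continuous_at)
      from tendsto_diff[OF tendsto_const[of "g x"] this]
      show "(\<lambda>k. g x - translate (h k) g x) \<longlonglongrightarrow> 0"
        by (simp add: translate_def)
    qed
    show "AE x in lebesgue. \<bar>g x - translate (h k) g x\<bar> \<le> \<bar>2 * B * indicator {-2..3::real} x\<bar>" for k
    proof (rule AE_I2)
      fix x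
      show "\<bar>g x - translate (h k) g x\<bar> \<le> \<bar>2 * B * indicator {-2..3::real} x\<bar>"
      proof (cases "x \<in> {-2..3}")
        case True
        then show ?thesis
          using g(3)[of x] g(3)[of "x + h k"] B by (simp add: translate_def)
      next
        case False
        then have "g x = 0" "g (x + h k) = 0"
          using h1[of k] by (auto intro!: g(2))
        then show ?thesis by (simp add: translate_def)
      qed
    qed
  qed
  then have "\<forall>\<^sub>F k in sequentially. Lp_norm lebesgue p (\<lambda>x. g x - translate (h k) g x) < e"
    using e by (rule order_tendstoD)
  then show False
    using h(2) by (auto dest: eventually_happens)
qed

text \<open>The definition of \<open>measurable_on\<close> supplies continuous functions converging
  to u off a negligible set. Clipping them to [-B,B] and multiplying by a trapezoid that is 1 on
  [0,1] keeps the limit and provides a common majorant, so they converge in norm too.\<close>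

lemma shift_continuous_bounded:
  assumes p: "1 \<le> p" and u: "u \<in> borel_measurable lebesgue" "\<And>x. x \<notin> {0..1} \<Longrightarrow> u x = 0"
    "\<And>x. \<bar>u x\<bar> \<le> B"
  shows "shift_continuous p u"
proof -
  have "u measurable_on UNIV"
    using u(1) by (simp add: measurable_on_iff_borel_measurable)
  then obtain N v where N: "negligible N" and v: "\<And>n. continuous_on UNIV (v n)"
    and lim: "\<And>x. x \<notin> N \<Longrightarrow> (\<lambda>n. v n x) \<longlonglongrightarrow> u x"
    by (auto simp: measurable_on_def)
  have B: "0 \<le> B"
    using u(3)[of 0] by linarith
  define cut :: "real \<Rightarrow> real" where "cut x = max 0 (min 1 (3 / 2 - \<bar>x - 1 / 2\<bar>))" for x
  have cut: "0 \<le> cut x" "cut x \<le> 1" "x \<in> {0..1} \<Longrightarrow> cut x = 1" "x \<notin> {-1..2} \<Longrightarrow> cut x = 0" for x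
    by (auto simp: cut_def)
  define g where "g n x = cut x * max (- B) (min B (v n x))" for n x
  have gc: "continuous_on UNIV (g n)" for n
    unfolding g_def cut_def using v[of n] by (intro continuous_intros)
  have gB: "\<bar>g n x\<bar> \<le> B" for n x
  proof -
    have "\<bar>max (- B) (min B (v n x))\<bar> \<le> B"
      using B by auto
    then have "cut x * \<bar>max (- B) (min B (v n x))\<bar> \<le> 1 * B"
      using cut by (intro mult_mono) auto
    then show ?thesis
      using cut(1)[of x] by (simp add: g_def abs_mult)
  qed
  have g0: "g n x = 0" if "x \<notin> {-1..2}" for n x
    using cut(4)[OF that] by (simp add: g_def)
  have [measurable]: "g n \<in> borel_measurable lebesgue" for n
    using borel_measurable_continuous_onI[OF gc] by (auto intro: measurable_completion)
  note [measurable] = u(1)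
  have glim: "(\<lambda>n. u x - g n x) \<longlonglongrightarrow> 0" if "x \<notin> N" for x
  proof -
    have "(\<lambda>n. g n x) \<longlonglongrightarrow> cut x * max (- B) (min B (u x))"
      unfolding g_def by (intro tendsto_intros lim that)
    also have "max (- B) (min B (u x)) = u x"
      using u(3)[of x] by (auto simp: min_def max_def)
    also have "cut x * u x = u x"
      using u(2)[of x] cut(3)[of x] by (cases "x \<in> {0..1}") auto
    finally show ?thesis
      using tendsto_diff[OF tendsto_const[of "u x"]] by fastforce
  qed
  show ?thesis
  proof (rule shift_continuous_limit[OF p])
    show "u \<in> Lp_space lebesgue p"
      by (rule Lp_norm_bounded_support[where A = "{0..1}" and m = 1 and c = B]) (use p u B in auto)
    show "g n \<in> Lp_space lebesgue p" for n
      by (rule Lp_norm_bounded_support[where A = "{-1..2}" and m = 3 and c = B]) (use p g0 gB B in auto)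
    show "shift_continuous p (g n)" for n
      using shift_continuous_compact_support[OF p gc g0 gB] .
    show "(\<lambda>n. Lp_norm lebesgue p (\<lambda>x. u x - g n x)) \<longlonglongrightarrow> 0"
    proof (rule Lp_norm_dominated_convergence[OF p, where G = "\<lambda>x. 2 * B * indicator {-1..2::real} x"])
      show "(\<lambda>x. 2 * B * indicator {-1..2::real} x) \<in> Lp_space lebesgue p"
        by (rule Lp_norm_bounded_support[where A = "{-1..2}" and m = 3 and c = "2 * B"])
          (use p B in \<open>auto split: split_indicator intro!: borel_measurable_times borel_measurable_indicator\<close>)
      show "AE x in lebesgue. (\<lambda>n. u x - g n x) \<longlonglongrightarrow> 0"
        using N glim by (intro AE_I'[of N]) (auto simp: negligible_iff_null_sets)
      have "\<bar>u x - g n x\<bar> \<le> \<bar>2 * B * indicator {-1..2::real} x\<bar>" for n x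
        using u(2)[of x] g0[of x n] u(3)[of x] gB[of n x] B by (cases "x \<in> {-1..2}") auto
      then show "AE x in lebesgue. \<bar>u x - g n x\<bar> \<le> \<bar>2 * B * indicator {-1..2::real} x\<bar>" for n
        by simp
    qed measurable
  qed
qed

text \<open>Truncation at height k converges to the function in norm, with the function itself
  dominating the error.\<close>

lemma shift_continuous_zero_ext:
  assumes p: "1 \<le> p" and f: "f \<in> Lp_funs p"
  shows "shift_continuous p (zero_ext f)"
proof -
  let ?f = "zero_ext f"
  define g where "g k x = max (- real k) (min (real k) (?f x))" for k x
  have F: "?f \<in> Lp_space lebesgue p"
    by (rule zero_ext_Lp_space[OF p f])
  then have [measurable]: "?f \<in> borel_measurable lebesgue"
    by (rule Lp_space_measurable)
  have [measurable]: "g k \<in> borel_measurable lebesgue" for k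
    unfolding g_def by measurable
  show ?thesis
  proof (rule shift_continuous_limit[OF p F])
    show "g k \<in> Lp_space lebesgue p" for k
      by (rule Lp_space_bound[OF F]) (use p in \<open>auto simp: g_def\<close>)
    show "shift_continuous p (g k)" for k
      by (rule shift_continuous_bounded[OF p, where B = "real k"]) (auto simp: g_def zero_ext_def)
    show "(\<lambda>k. Lp_norm lebesgue p (\<lambda>x. ?f x - g k x)) \<longlonglongrightarrow> 0"
    proof (rule Lp_norm_dominated_convergence[OF p _ F])
      show "AE x in lebesgue. (\<lambda>k. ?f x - g k x) \<longlonglongrightarrow> 0"
      proof (rule AE_I2)
        fix x
        obtain m :: nat where "\<bar>?f x\<bar> \<le> real m"
          using real_arch_simple by blast
        then have "\<forall>\<^sub>F k in sequentially. ?f x - g k x = 0"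
          by (intro eventually_sequentiallyI[of m]) (auto simp: g_def)
        then show "(\<lambda>k. ?f x - g k x) \<longlonglongrightarrow> 0"
          by (rule tendsto_eventually)
      qed
      show "AE x in lebesgue. \<bar>?f x - g k x\<bar> \<le> \<bar>?f x\<bar>" for k
        by (auto simp: g_def)
    qed measurable
  qed
qed

section \<open>A common modulus for totally bounded sets\<close>

lemma mtotally_bounded_imp_modulus:
  assumes p: "1 \<le> p" and K: "Metric_space.mtotally_bounded (Lp p) (Lp_dist p) K"
  shows "\<exists>l. K \<subseteq> Lp_modulus_class p l"
proof -
  interpret Metric_space "Lp p" "Lp_dist p"
    by (rule Metric_space_Lp[OF p])
  have KL: "K \<subseteq> Lp p"
    using K mtotally_bounded_imp_subset by blast
  have "\<exists>m. \<forall>F\<in>K. \<forall>f\<in>F. \<forall>h. \<bar>h\<bar> \<le> 1 / 2 ^ m \<longrightarrow>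
      Lp_norm lebesgue p (\<lambda>x. zero_ext f x - translate h (zero_ext f) x) < 1 / 2 ^ n" for n :: nat
  proof -
    \<comment> \<open>The radius 2^-(n+2) enters twice in \<open>Lp_norm_shift_le\<close>, which
      leaves 2^-(n+1) for the shift of the centre.\<close>
    obtain C where C: "finite C" "C \<subseteq> K" "K \<subseteq> (\<Union>G\<in>C. mball G (1 / 2 ^ (n + 2)))"
      using K unfolding mtotally_bounded_def
      by (metis zero_less_divide_1_iff zero_less_numeral zero_less_power)
    have "\<exists>m. \<forall>h. \<bar>h\<bar> \<le> 1 / 2 ^ m \<longrightarrow>
        Lp_norm lebesgue p (\<lambda>x. zero_ext g x - translate h (zero_ext g) x) < 1 / 2 ^ (n + 1)"
      if "g \<in> Lp_funs p" for g
    proof -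
      have "(0::real) < 1 / 2 ^ (n + 1)" by simp
      then obtain \<delta> where \<delta>: "\<delta> > 0" "\<forall>h. \<bar>h\<bar> \<le> \<delta> \<longrightarrow>
          Lp_norm lebesgue p (\<lambda>x. zero_ext g x - translate h (zero_ext g) x) < 1 / 2 ^ (n + 1)"
        using shift_continuous_zero_ext[OF p \<open>g \<in> Lp_funs p\<close>] unfolding shift_continuous_def by blast
      obtain m where "(1 / 2) ^ m < \<delta>"
        using real_arch_pow_inv[OF \<delta>(1), of "1 / 2"] by auto
      then show ?thesis
        using \<delta>(2) by (intro exI[of _ m]) (auto simp: power_divide)
    qed
    then obtain m where m: "\<And>g h. g \<in> Lp_funs p \<Longrightarrow> \<bar>h\<bar> \<le> 1 / 2 ^ m g \<Longrightarrow>
        Lp_norm lebesgue p (\<lambda>x. zero_ext g x - translate h (zero_ext g) x) < 1 / 2 ^ (n + 1)"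
      by metis
    define rep :: "(real \<Rightarrow> real) set \<Rightarrow> real \<Rightarrow> real" where "rep G = (SOME g. g \<in> G)" for G
    \<comment> \<open>The sum stands in for a maximum: it is at least each summand.\<close>
    define m' where "m' = (\<Sum>G\<in>C. m (rep G))"
    show ?thesis
    proof (intro exI[of _ m'] ballI allI impI)
      define E :: real where "E = 1 / 2 ^ n"
      fix F f and h :: real assume F: "F \<in> K" "f \<in> F" and h: "\<bar>h\<bar> \<le> 1 / 2 ^ m'"
      obtain G where G: "G \<in> C" "F \<in> mball G (1 / 2 ^ (n + 2))"
        using C F by blast
      have L: "F \<in> Lp p" "G \<in> Lp p"
        using F G C KL by auto
      have g: "rep G \<in> G"
        using Lp_some_in[OF L(2)] by (simp add: rep_def)
      have fg: "f \<in> Lp_funs p" "rep G \<in> Lp_funs p"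
        using Lp_class_subset L F g by blast+
      have "Lp_dist p F G < 1 / 2 ^ (n + 2)"
        using G by (simp add: commute)
      then have d: "Lp_norm lebesgue p (\<lambda>x. zero_ext f x - zero_ext (rep G) x) < 1 / 2 ^ (n + 2)"
        using Lp_dist_eq[OF p L(1) F(2) L(2) g] Lp_norm_zero_ext[OF p, of "\<lambda>x. f x - rep G x"]
        by (simp add: zero_ext_diff)
      have "m (rep G) \<le> m'"
        unfolding m'_def using C(1) G(1) by (intro member_le_sum) auto
      then have "(1::real) / 2 ^ m' \<le> 1 / 2 ^ m (rep G)"
        by (simp add: frac_le)
      then have "Lp_norm lebesgue p (\<lambda>x. zero_ext (rep G) x - translate h (zero_ext (rep G)) x) < 1 / 2 ^ (n + 1)"
        using h by (intro m fg) auto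
      then have "Lp_norm lebesgue p (\<lambda>x. zero_ext (rep G) x - translate h (zero_ext (rep G)) x) < (1 / 2 ^ n) / 2"
        by simp
      moreover have "Lp_norm lebesgue p (\<lambda>x. zero_ext f x - zero_ext (rep G) x) < (1 / 2 ^ n) / 4"
        using d by simp
      moreover note Lp_norm_shift_le[OF p zero_ext_Lp_space[OF p fg(1)] zero_ext_Lp_space[OF p fg(2)], of h]
      ultimately show "Lp_norm lebesgue p (\<lambda>x. zero_ext f x - translate h (zero_ext f) x) < 1 / 2 ^ n"
        unfolding E_def[symmetric] by linarith
    qed
  qed
  then obtain m where m: "\<And>n F f h. F \<in> K \<Longrightarrow> f \<in> F \<Longrightarrow> \<bar>h\<bar> \<le> 1 / 2 ^ m n \<Longrightarrow>
      Lp_norm lebesgue p (\<lambda>x. zero_ext f x - translate h (zero_ext f) x) < 1 / 2 ^ n"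
    by metis
  \<comment> \<open>Partial sums of \<open>m i + 1\<close> increase strictly, as the growth
    condition demands, and dominate \<open>m\<close>; a larger exponent only restricts the
    admissible shifts.\<close>
  define l where "l n = (\<Sum>i\<le>n. m i + 1)" for n :: nat
  have "modulus_growth l"
    by (simp add: modulus_growth_def l_def)
  moreover have "Lp_norm lebesgue p (\<lambda>x. zero_ext f x - translate h (zero_ext f) x) < 1 / 2 ^ n"
    if "F \<in> K" "f \<in> F" "\<bar>h\<bar> \<le> 1 / 2 ^ l n" for F f h n
  proof -
    have "m n \<le> l n"
      by (cases n) (auto simp: l_def)
    then have "(1::real) / 2 ^ l n \<le> 1 / 2 ^ m n"
      by (simp add: frac_le)
    then show ?thesis
      using that by (intro m) auto
  qed
  ultimately show ?thesis
    using KL by (intro exI[of _ l]) (auto simp: Lp_modulus_class_def Lp_modulus_def)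
qed

section \<open>Averages over dyadic cells\<close>

text \<open>The long shift is composed of k short ones, each of the same cost by translation
  invariance.\<close>

lemma Lp_norm_shift_multiple:
  assumes p: "1 \<le> p" and g: "g \<in> Lp_space lebesgue p"
  shows "Lp_norm lebesgue p (\<lambda>x. g x - translate (real k * h) g x)
    \<le> real k * Lp_norm lebesgue p (\<lambda>x. g x - translate h g x)"
proof (induction k)
  case 0
  then show ?case using p by (simp add: translate_def Lp_norm_def)
next
  case (Suc k)
  have m: "(\<lambda>x. g x - translate (real k * h) g x) \<in> borel_measurable lebesgue"
    using p g by (intro Lp_space_measurable Lp_space_diff translate_Lp_space)
  have "translate h (\<lambda>x. g x - translate (real k * h) g x)
      = (\<lambda>x. translate h g x - translate (real (Suc k) * h) g x)"
    by (auto simp: translate_def algebra_simps)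
  then have "Lp_norm lebesgue p (\<lambda>x. translate h g x - translate (real (Suc k) * h) g x)
      = Lp_norm lebesgue p (\<lambda>x. g x - translate (real k * h) g x)"
    using Lp_norm_translate[OF m, of p h] by simp
  moreover have "Lp_norm lebesgue p (\<lambda>x. g x - translate (real (Suc k) * h) g x)
      \<le> Lp_norm lebesgue p (\<lambda>x. g x - translate h g x)
        + Lp_norm lebesgue p (\<lambda>x. translate h g x - translate (real (Suc k) * h) g x)"
    using p g by (intro Lp_norm_diff_triangle translate_Lp_space)
  ultimately show ?case
    using Suc by (simp add: algebra_simps)
qed

lemma Lp_modulus_norm_le:
  assumes p: "1 \<le> p" and f: "f \<in> Lp_funs p" and l: "Lp_modulus p l f"
  shows "Lp_norm lebesgue p (zero_ext f) \<le> 2 ^ l 0"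
proof -
  let ?g = "zero_ext f"
  have g: "?g \<in> Lp_space lebesgue p"
    by (rule zero_ext_Lp_space[OF p f])
  \<comment> \<open>The function shifted by 1 lives on [-1,0], which meets [0,1] only in the point
    0.\<close>
  have "AE x in lebesgue. x \<noteq> (0::real)"
    by (intro AE_completion AE_lborel_singleton)
  then have "AE x in lebesgue. \<bar>?g x\<bar> \<le> \<bar>?g x - translate 1 ?g x\<bar>"
    by eventually_elim (auto simp: translate_def zero_ext_def)
  then have "Lp_norm lebesgue p ?g \<le> Lp_norm lebesgue p (\<lambda>x. ?g x - translate 1 ?g x)"
    using p g by (intro Lp_norm_mono Lp_space_diff translate_Lp_space Lp_space_measurable)
  also have "\<dots> \<le> real (2 ^ l 0) * Lp_norm lebesgue p (\<lambda>x. ?g x - translate (1 / 2 ^ l 0) ?g x)"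
    using Lp_norm_shift_multiple[OF p g, of "2 ^ l 0" "1 / 2 ^ l 0"] by simp
  also have "\<dots> \<le> real (2 ^ l 0) * 1"
    using l by (intro mult_left_mono) (auto simp: Lp_modulus_def dest!: spec[of _ 0] spec[of _ "1 / 2 ^ l 0"])
  finally show ?thesis by simp
qed

text \<open>The Tonelli argument below needs g(x + h) jointly measurable in x and h, which Borel
  measurability of g ensures. A Lebesgue measurable function agrees almost everywhere with a Borel
  one, and extending that by zero again restores the support.\<close>

lemma Lp_borel_representative:
  assumes p: "1 \<le> p" and F: "F \<in> Lp p"
  obtains g where "g \<in> F" "g \<in> borel_measurable borel" "zero_ext g = g"
proof -
  obtain f where f: "f \<in> F" "f \<in> Lp_funs p"
    using Lp_some_in[OF F] Lp_class_subset[OF F] by blast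
  have "zero_ext f \<in> borel_measurable (completion lborel)"
    using f by (intro zero_ext_measurable) (simp add: Lp_funs_def)
  then obtain g0 where g0: "g0 \<in> borel_measurable lborel" "AE x in lborel. zero_ext f x = g0 x"
    using completion_ex_borel_measurable_real by blast
  define g where "g = zero_ext g0"
  have [measurable]: "g \<in> borel_measurable borel"
    unfolding g_def zero_ext_def[abs_def] using g0(1) by measurable
  have gM: "g \<in> borel_measurable (lebesgue_on {0..1})"
    by (intro measurable_restrict_space1 measurable_completion) simp
  have "AE x in lebesgue. zero_ext f x = g0 x"
    by (rule AE_completion[OF g0(2)])
  then have "AE x in lebesgue. x \<in> {0..1} \<longrightarrow> f x = g x"
    by eventually_elim (auto simp: g_def zero_ext_def)
  then have ae: "AE x in lebesgue_on {0..1}. f x = g x"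
    by (simp add: AE_restrict_space_iff)
  then have "AE x in lebesgue_on {0..1}. \<bar>g x\<bar> \<le> \<bar>f x\<bar>"
    by eventually_elim simp
  then have "g \<in> Lp_funs p"
    using Lp_space_bound[OF _ gM] f p by (auto simp: Lp_funs_eq)
  with ae f have "(f, g) \<in> Lp_eq p"
    by (simp add: Lp_eq_def)
  then have "g \<in> F"
    using F f in_quotient_imp_closed[OF equiv_Lp_eq] by (metis Lp_def)
  moreover have "zero_ext g = g"
    by (auto simp: g_def zero_ext_def)
  ultimately show ?thesis
    using that by simp
qed

text \<open>The mean of g over the j-th cell of length 1 / M. Half-open cells partition the line, so
  the cell of x has index \<open>\<lfloor>M * x\<rfloor>\<close>.\<close>

definition cell_average :: "real \<Rightarrow> (real \<Rightarrow> real) \<Rightarrow> int \<Rightarrow> real" where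
  "cell_average M g j = M * (\<integral>y. g y \<partial>restrict_space lborel {of_int j / M ..< (of_int j + 1) / M})"

lemma cell_iff:
  assumes "0 < (M::real)"
  shows "y \<in> {of_int j / M ..< (of_int j + 1) / M} \<longleftrightarrow> \<lfloor>M * y\<rfloor> = j"
  using assms by (auto simp: field_simps floor_eq_iff)

lemma cell_measure:
  assumes "0 < (M::real)"
  shows "finite_measure (restrict_space lborel {of_int j / M ..< (of_int j + 1) / M})"
    "measure (restrict_space lborel {of_int j / M ..< (of_int j + 1) / M})
       (space (restrict_space lborel {of_int j / M ..< (of_int j + 1) / M})) = 1 / M"
proof -
  have "emeasure lborel {of_int j / M ..< (of_int j + 1) / M} = ennreal (1 / M)"
    using assms by (subst emeasure_lborel_Ico) (auto simp: divide_right_mono simp flip: diff_divide_distrib)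
  then show "finite_measure (restrict_space lborel {of_int j / M ..< (of_int j + 1) / M})"
    "measure (restrict_space lborel {of_int j / M ..< (of_int j + 1) / M})
       (space (restrict_space lborel {of_int j / M ..< (of_int j + 1) / M})) = 1 / M"
    using assms by (auto intro!: finite_measureI simp: space_restrict_space emeasure_restrict_space measure_def)
qed

lemma Lp_space_lborel:
  assumes "g \<in> borel_measurable borel"
  shows "g \<in> Lp_space lebesgue p \<longleftrightarrow> g \<in> Lp_space lborel p"
    "Lp_norm lebesgue p g = Lp_norm lborel p g"
proof -
  have [measurable]: "g \<in> borel_measurable lborel" using assms by simp
  then show "g \<in> Lp_space lebesgue p \<longleftrightarrow> g \<in> Lp_space lborel p"
    "Lp_norm lebesgue p g = Lp_norm lborel p g"
    by (auto simp: Lp_space_def Lp_norm_def integrable_completion integral_completion measurable_completion)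
qed

lemma Lp_space_cell:
  assumes g: "g \<in> Lp_space lborel p"
  shows "g \<in> Lp_space (restrict_space lborel {a..<b::real}) p"
proof -
  have "integrable lborel (\<lambda>x. indicator {a..<b} x *\<^sub>R \<bar>g x\<bar> powr p)"
    using g by (intro integrable_mult_indicator) (auto simp: Lp_space_def)
  then show ?thesis
    using g by (auto simp: Lp_space_def integrable_restrict_space intro: measurable_restrict_space1)
qed

lemma Lp_space_const:
  assumes "finite_measure M" 
  shows "(\<lambda>x. c) \<in> Lp_space M p"
  using assms by (simp add: Lp_space_def finite_measure.integrable_const)

text \<open>Jensen bounds the p-th power by M times that of the norm. Enlarging M to M^p, possible
  for M \<ge> 1, makes the bound free of p; it limits the number of rounded values.\<close>

lemma cell_average_bound:
  assumes p: "1 \<le> p" and g: "g \<in> Lp_space lborel p" and M: "1 \<le> M"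
  shows "\<bar>cell_average M g j\<bar> \<le> M * Lp_norm lborel p g"
proof -
  let ?N = "restrict_space lborel {of_int j / M ..< (of_int j + 1) / M}"
  have M0: "0 < M" using M by simp
  note J = Jensen_powr[OF p cell_measure[OF M0] _ Lp_space_cell[OF g], of j]
  have gi: "integrable lborel (\<lambda>x. \<bar>g x\<bar> powr p)"
    using g by (simp add: Lp_space_def)
  have "\<bar>cell_average M g j\<bar> powr p = (\<bar>\<integral>y. g y \<partial>?N\<bar> / (1 / M)) powr p"
    using M by (simp add: cell_average_def abs_mult mult.commute)
  also have "\<dots> \<le> (\<integral>y. \<bar>g y\<bar> powr p \<partial>?N) / (1 / M)"
    using J(2) M by simp
  also have "\<dots> = M * (\<integral>y. \<bar>g y\<bar> powr p \<partial>?N)"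
    by simp
  also have "(\<integral>y. \<bar>g y\<bar> powr p \<partial>?N) \<le> (\<integral>y. \<bar>g y\<bar> powr p \<partial>lborel)"
    using gi integrable_mult_indicator[OF _ gi, of "{of_int j / M ..< (of_int j + 1) / M}"]
    by (subst integral_restrict_space) (auto intro!: integral_mono split: split_indicator)
  also have "\<dots> = Lp_norm lborel p g powr p"
    by (simp add: Lp_norm_powr[OF p])
  also have "M * Lp_norm lborel p g powr p \<le> M powr p * Lp_norm lborel p g powr p"
    using powr_mono[OF p M] M by (intro mult_right_mono) auto
  also have "\<dots> = (M * Lp_norm lborel p g) powr p"
    by (simp add: powr_mult)
  finally have "\<bar>cell_average M g j\<bar> powr p \<le> (M * Lp_norm lborel p g) powr p"
    using M by simp
  then show ?thesis
    using p M by (meson Lp_norm_nonneg M0 abs_ge_zero less_eq_real_def mult_nonneg_nonneg not_le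
        powr_less_mono2 order_less_le_trans zero_less_one)
qed

text \<open>The deviation is the mean of g(x) - g(y) over the cell of x, so Jensen applies.
  Enlarging the cell to the window of all y with |y - x| \<le> 1 / M makes the domain depend on y -
  x only, which prepares the exchange of integrals.\<close>

lemma cell_average_deviation:
  assumes p: "1 \<le> p" and g: "g \<in> Lp_space lborel p" and M: "0 < M"
  shows "ennreal (\<bar>g x - cell_average M g \<lfloor>M * x\<rfloor>\<bar> powr p)
    \<le> ennreal M * (\<integral>\<^sup>+y. ennreal (\<bar>g x - g y\<bar> powr p) * indicator {- 1 / M..1 / M} (y - x) \<partial>lborel)"
proof -
  let ?C = "{of_int \<lfloor>M * x\<rfloor> / M ..< (of_int \<lfloor>M * x\<rfloor> + 1) / M}"
  let ?N = "restrict_space lborel ?C"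
  have N: "finite_measure ?N" "measure ?N (space ?N) = 1 / M"
    using cell_measure[OF M] by auto
  have gN: "g \<in> Lp_space ?N p"
    by (rule Lp_space_cell[OF g])
  then have u: "(\<lambda>y. g x - g y) \<in> Lp_space ?N p"
    by (intro Lp_space_diff[OF p] Lp_space_const N)
  have [measurable]: "g \<in> borel_measurable borel"
    using g by (simp add: Lp_space_def)
  have diff: "(\<integral>y. g x - g y \<partial>?N) = g x / M - (\<integral>y. g y \<partial>?N)"
    using Jensen_powr(1)[OF p N _ gN] M N by (subst Bochner_Integration.integral_diff)
      (auto simp: finite_measure.integrable_const)
  have "(\<bar>\<integral>y. g x - g y \<partial>?N\<bar> / (1 / M)) = \<bar>g x - cell_average M g \<lfloor>M * x\<rfloor>\<bar>"
  proof -
    have "M * (g x / M - (\<integral>y. g y \<partial>?N)) = g x - cell_average M g \<lfloor>M * x\<rfloor>"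
      using M by (simp add: cell_average_def right_diff_distrib)
    then have "\<bar>g x - cell_average M g \<lfloor>M * x\<rfloor>\<bar> = \<bar>M\<bar> * \<bar>g x / M - (\<integral>y. g y \<partial>?N)\<bar>"
      by (metis abs_mult)
    then show ?thesis
      using M diff by (simp add: mult.commute)
  qed
  with Jensen_powr(2)[OF p N _ u] M
  have "\<bar>g x - cell_average M g \<lfloor>M * x\<rfloor>\<bar> powr p \<le> M * (\<integral>y. \<bar>g x - g y\<bar> powr p \<partial>?N)"
    by (simp add: mult.commute)
  then have "ennreal (\<bar>g x - cell_average M g \<lfloor>M * x\<rfloor>\<bar> powr p)
      \<le> ennreal M * ennreal (\<integral>y. \<bar>g x - g y\<bar> powr p \<partial>?N)"
    using M by (simp flip: ennreal_mult)
  also have "ennreal (\<integral>y. \<bar>g x - g y\<bar> powr p \<partial>?N) = (\<integral>\<^sup>+y. ennreal (\<bar>g x - g y\<bar> powr p) \<partial>?N)"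
    using u by (intro nn_integral_eq_integral[symmetric]) (auto simp: Lp_space_def)
  also have "\<dots> = (\<integral>\<^sup>+y. ennreal (\<bar>g x - g y\<bar> powr p) * indicator ?C y \<partial>lborel)"
    by (rule nn_integral_restrict_space) simp
  also have "\<dots> \<le> (\<integral>\<^sup>+y. ennreal (\<bar>g x - g y\<bar> powr p) * indicator {- 1 / M..1 / M} (y - x) \<partial>lborel)"
  proof (intro nn_integral_mono mult_left_mono)
    fix y
    have "y - x \<in> {- 1 / M..1 / M}" if "y \<in> ?C"
    proof -
      have "\<lfloor>M * y\<rfloor> = \<lfloor>M * x\<rfloor>"
        using that by (simp only: cell_iff[OF M])
      then have "\<bar>M * y - M * x\<bar> \<le> 1"
        by linarith
      then have "M * (y - x) \<le> 1" "- 1 \<le> M * (y - x)"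
        by (auto simp: right_diff_distrib)
      then show ?thesis
        using M by (auto simp: field_simps)
    qed
    then show "indicator ?C y \<le> (indicator {- 1 / M..1 / M} (y - x) :: ennreal)"
      by (simp split: split_indicator)
  qed simp
  finally show ?thesis
    using M by (simp add: mult_left_mono)
qed

text \<open>Integrating the pointwise deviation over x, substituting h = y - x and applying Tonelli
  leaves an integral over shifts h. Each shift contributes at most s^p and the window has length 2 /
  M, so the total is 2 s^p \<le> (2 s)^p.\<close>

lemma cell_average_approx:
  assumes p: "1 \<le> p" and gb [measurable]: "g \<in> borel_measurable borel" and g: "g \<in> Lp_space lebesgue p"
    and M: "0 < M" and s: "0 \<le> s"
    and shift: "\<And>h. \<bar>h\<bar> \<le> 1 / M \<Longrightarrow> Lp_norm lebesgue p (\<lambda>x. g x - translate h g x) \<le> s"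
  shows "(\<lambda>x. g x - cell_average M g \<lfloor>M * x\<rfloor>) \<in> Lp_space lborel p"
    "Lp_norm lborel p (\<lambda>x. g x - cell_average M g \<lfloor>M * x\<rfloor>) \<le> 2 * s"
proof -
  have gl: "g \<in> Lp_space lborel p"
    using Lp_space_lborel(1)[OF gb] g by simp
  have [measurable]: "(\<lambda>x. cell_average M g \<lfloor>M * x\<rfloor>) \<in> borel_measurable lborel"
    by (rule measurable_compose[of "\<lambda>x. \<lfloor>M * x\<rfloor>" _ "count_space UNIV"]) measurable
  have inner: "(\<integral>\<^sup>+x. ennreal (\<bar>g x - g (x + h)\<bar> powr p) \<partial>lborel) \<le> ennreal (s powr p)"
    if "\<bar>h\<bar> \<le> 1 / M" for h
  proof -
    have "(\<integral>\<^sup>+x. ennreal (\<bar>g x - g (x + h)\<bar> powr p) \<partial>lborel)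
        = (\<integral>\<^sup>+x. ennreal (\<bar>g x - translate h g x\<bar> powr p) \<partial>lebesgue)"
      by (simp add: nn_integral_completion translate_def)
    also have "\<dots> = ennreal (Lp_norm lebesgue p (\<lambda>x. g x - translate h g x) powr p)"
      using g p by (intro nn_integral_Lp_norm Lp_space_diff translate_Lp_space)
    also have "\<dots> \<le> ennreal (s powr p)"
      using shift[OF that] p by (intro ennreal_leI powr_mono2) (auto simp: Lp_norm_nonneg)
    finally show ?thesis .
  qed
  let ?I = "\<lambda>h. indicator {- 1 / M..1 / M} h :: ennreal"
  have "(\<integral>\<^sup>+x. ennreal (\<bar>g x - cell_average M g \<lfloor>M * x\<rfloor>\<bar> powr p) \<partial>lborel)
      \<le> (\<integral>\<^sup>+x. ennreal M * (\<integral>\<^sup>+y. ennreal (\<bar>g x - g y\<bar> powr p) * ?I (y - x) \<partial>lborel) \<partial>lborel)"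
    by (intro nn_integral_mono cell_average_deviation p gl M)
  also have "\<dots> = ennreal M * (\<integral>\<^sup>+x. (\<integral>\<^sup>+y. ennreal (\<bar>g x - g y\<bar> powr p) * ?I (y - x) \<partial>lborel) \<partial>lborel)"
    by (intro nn_integral_cmult) measurable
  also have "(\<integral>\<^sup>+x. (\<integral>\<^sup>+y. ennreal (\<bar>g x - g y\<bar> powr p) * ?I (y - x) \<partial>lborel) \<partial>lborel)
      = (\<integral>\<^sup>+x. (\<integral>\<^sup>+h. ennreal (\<bar>g x - g (x + h)\<bar> powr p) * ?I h \<partial>lborel) \<partial>lborel)"
  proof (rule nn_integral_cong)
    fix x
    show "(\<integral>\<^sup>+y. ennreal (\<bar>g x - g y\<bar> powr p) * ?I (y - x) \<partial>lborel)
        = (\<integral>\<^sup>+h. ennreal (\<bar>g x - g (x + h)\<bar> powr p) * ?I h \<partial>lborel)"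
      by (subst nn_integral_real_affine[where c = 1 and t = x]) auto
  qed
  also have "\<dots> = (\<integral>\<^sup>+h. (\<integral>\<^sup>+x. ennreal (\<bar>g x - g (x + h)\<bar> powr p) * ?I h \<partial>lborel) \<partial>lborel)"
    by (rule lborel_pair.Fubini') measurable
  also have "\<dots> = (\<integral>\<^sup>+h. (\<integral>\<^sup>+x. ennreal (\<bar>g x - g (x + h)\<bar> powr p) \<partial>lborel) * ?I h \<partial>lborel)"
    by (intro nn_integral_cong nn_integral_multc) measurable
  also have "\<dots> \<le> (\<integral>\<^sup>+h. ennreal (s powr p) * ?I h \<partial>lborel)"
    using inner by (intro nn_integral_mono) (auto split: split_indicator)
  also have "\<dots> = ennreal (s powr p) * ennreal (2 / M)"
    using M by (subst nn_integral_cmult_indicator) (auto simp: emeasure_lborel_Icc)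
  also have "ennreal M * (ennreal (s powr p) * ennreal (2 / M)) = ennreal (2 * s powr p)"
    using M by (simp flip: ennreal_mult)
  also have "\<dots> \<le> ennreal ((2 * s) powr p)"
    using powr_mono[of 1 p 2] p s by (intro ennreal_leI) (auto simp: powr_mult intro!: mult_right_mono)
  finally have *: "(\<integral>\<^sup>+x. ennreal (\<bar>g x - cell_average M g \<lfloor>M * x\<rfloor>\<bar> powr p) \<partial>lborel)
      \<le> ennreal ((2 * s) powr p)"
    using M by (auto simp: mult_left_mono)
  show "(\<lambda>x. g x - cell_average M g \<lfloor>M * x\<rfloor>) \<in> Lp_space lborel p"
    "Lp_norm lborel p (\<lambda>x. g x - cell_average M g \<lfloor>M * x\<rfloor>) \<le> 2 * s"
    by (rule Lp_norm_leI[OF _ *]; use p s in simp)+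
qed

section \<open>Coverings by dyadic step functions\<close>

text \<open>The values are integer multiples of \<delta>, so a step function is coded by an integer
  vector with 2^m relevant entries. The point 1 lies in no cell of [0,1) and gets the value
  0.\<close>

definition dyadic_step :: "nat \<Rightarrow> real \<Rightarrow> (nat \<Rightarrow> int) \<Rightarrow> real \<Rightarrow> real" where
  "dyadic_step m \<delta> k x = (if x \<in> {0..<1} then \<delta> * of_int (k (nat \<lfloor>2 ^ m * x\<rfloor>)) else 0)"

lemma dyadic_index_less:
  assumes "x \<in> {0..<1::real}"
  shows "0 \<le> \<lfloor>2 ^ m * x\<rfloor>" "nat \<lfloor>2 ^ m * x\<rfloor> < 2 ^ m"
proof -
  have "\<lfloor>2 ^ m * x\<rfloor> < 2 ^ m"
    using assms by (simp add: floor_less_iff)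
  then show "0 \<le> \<lfloor>2 ^ m * x\<rfloor>" "nat \<lfloor>2 ^ m * x\<rfloor> < 2 ^ m"
    using assms by (auto simp: nat_less_iff)
qed

lemma dyadic_step_Lp_funs:
  assumes p: "1 \<le> p" and k: "\<And>i. i < 2 ^ m \<Longrightarrow> k i \<in> {- B..B}"
  shows "dyadic_step m \<delta> k \<in> Lp_funs p"
proof -
  have "(\<lambda>x::real. real_of_int (k (nat \<lfloor>2 ^ m * x\<rfloor>))) \<in> borel_measurable borel"
    by (rule measurable_compose[of "\<lambda>x. \<lfloor>2 ^ m * x\<rfloor>" _ "count_space UNIV"]) measurable
  then have "dyadic_step m \<delta> k \<in> borel_measurable borel"
    unfolding dyadic_step_def[abs_def] by measurable
  then have mb: "dyadic_step m \<delta> k \<in> borel_measurable (lebesgue_on {0..1})"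
    by (intro measurable_restrict_space1 measurable_completion) simp
  have B: "0 \<le> B"
    using k[of 0] by simp
  have le: "\<bar>dyadic_step m \<delta> k x\<bar> \<le> \<bar>\<delta>\<bar> * of_int B" for x
  proof (cases "x \<in> {0..<1}")
    case True
    then have "\<bar>k (nat \<lfloor>2 ^ m * x\<rfloor>)\<bar> \<le> B"
      using k[OF dyadic_index_less(2)[OF True]] by auto
    then have "\<bar>real_of_int (k (nat \<lfloor>2 ^ m * x\<rfloor>))\<bar> \<le> of_int B"
      by linarith
    then show ?thesis
      using True by (auto simp: dyadic_step_def abs_mult intro: mult_left_mono)
  qed (use B in \<open>auto simp: dyadic_step_def\<close>)
  show ?thesis
    unfolding Lp_funs_eq
    by (rule Lp_norm_bounded_support[OF mb, where A = "{0..1}" and m = 1 and c = "\<bar>\<delta>\<bar> * of_int B"])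
      (use le B p in \<open>auto simp: emeasure_restrict_space sets_restrict_space_iff\<close>)
qed

lemma Lp_norm_lebesgue_on_le:
  fixes f :: "real \<Rightarrow> real"
  assumes "1 \<le> p" "f \<in> Lp_space lebesgue p"
  shows "f \<in> Lp_space (lebesgue_on {0..1}) p" "Lp_norm (lebesgue_on {0..1}) p f \<le> Lp_norm lebesgue p f"
proof -
  have m: "f \<in> borel_measurable (lebesgue_on {0..1})"
    using assms by (intro measurable_restrict_space1 Lp_space_measurable)
  have le: "AE x in lebesgue. \<bar>zero_ext f x\<bar> \<le> \<bar>f x\<bar>"
    by (simp add: zero_ext_def)
  have "integrable lebesgue (\<lambda>x. indicator {0..1} x *\<^sub>R \<bar>f x\<bar> powr p)"
    using assms by (intro integrable_mult_indicator) (auto simp: Lp_space_def)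
  then show "f \<in> Lp_space (lebesgue_on {0..1}) p"
    using m by (simp add: Lp_space_def integrable_restrict_space)
  show "Lp_norm (lebesgue_on {0..1}) p f \<le> Lp_norm lebesgue p f"
    using Lp_norm_mono[OF assms(2) zero_ext_measurable[OF m] le assms(1)]
    by (simp add: Lp_norm_zero_ext[OF assms(1)])
qed

text \<open>With E = 2^-(n+2), averaging costs 2 E and rounding to multiples of E costs E, in total
  3 E < 2^-n. Averages are at most 2^(m + l(0)) in absolute value; division by E gives the range of
  the integers.\<close>

lemma dyadic_step_approx:
  assumes p: "1 \<le> p" and F: "F \<in> Lp_modulus_class p l"
  obtains k where "\<And>i. i < 2 ^ l (n + 2) \<Longrightarrow> k i \<in> {- (2 ^ (l (n + 2) + l 0 + n + 2))..2 ^ (l (n + 2) + l 0 + n + 2)}"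
    "Lp_dist p (Lp_eq p `` {dyadic_step (l (n + 2)) (1 / 2 ^ (n + 2)) k}) F < 1 / 2 ^ n"
proof -
  let ?M = "lebesgue_on {0..1::real}"
  define m where "m = l (n + 2)"
  define E where "E = (1 / 2 ^ (n + 2) :: real)"
  define B where "B = (2 ^ (m + l 0 + n + 2) :: int)"
  have FL: "F \<in> Lp p"
    using F by (simp add: Lp_modulus_class_def)
  obtain g where g: "g \<in> F" "g \<in> borel_measurable borel" "zero_ext g = g"
    using Lp_borel_representative[OF p FL] .
  have gf: "g \<in> Lp_funs p"
    using Lp_class_subset[OF FL g(1)] .
  have gL: "g \<in> Lp_space lebesgue p"
    using zero_ext_Lp_space[OF p gf] g(3) by simp
  have l: "Lp_modulus p l g"
    using F g by (simp add: Lp_modulus_class_def)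
  have norm_g: "Lp_norm lborel p g \<le> 2 ^ l 0"
    using Lp_modulus_norm_le[OF p gf l] Lp_space_lborel(2)[OF g(2)] g(3) by simp
  have shift: "Lp_norm lebesgue p (\<lambda>x. g x - translate h g x) \<le> E" if "\<bar>h\<bar> \<le> 1 / 2 ^ m" for h
    using l that g(3) unfolding Lp_modulus_def m_def E_def by (metis less_eq_real_def)
  have E: "0 < E"
    by (simp add: E_def)
  define a where "a = cell_average (2 ^ m) g"
  have am [measurable]: "(\<lambda>x::real. a \<lfloor>2 ^ m * x\<rfloor>) \<in> borel_measurable borel"
    by (rule measurable_compose[of "\<lambda>x. \<lfloor>2 ^ m * x\<rfloor>" _ "count_space UNIV"]) measurable
  have ga0: "(\<lambda>x. g x - a \<lfloor>2 ^ m * x\<rfloor>) \<in> Lp_space lborel p"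
    "Lp_norm lborel p (\<lambda>x. g x - a \<lfloor>2 ^ m * x\<rfloor>) \<le> 2 * E"
    unfolding a_def using cell_average_approx[OF p g(2) gL, of "2 ^ m" E] shift E by auto
  have gab: "(\<lambda>x. g x - a \<lfloor>2 ^ m * x\<rfloor>) \<in> borel_measurable borel"
    using g(2) by measurable
  have "(\<lambda>x. g x - a \<lfloor>2 ^ m * x\<rfloor>) \<in> Lp_space lebesgue p"
    "Lp_norm lebesgue p (\<lambda>x. g x - a \<lfloor>2 ^ m * x\<rfloor>) \<le> 2 * E"
    using Lp_space_lborel[OF gab, of p] ga0 by auto
  then have ga: "(\<lambda>x. g x - a \<lfloor>2 ^ m * x\<rfloor>) \<in> Lp_space ?M p"
    "Lp_norm ?M p (\<lambda>x. g x - a \<lfloor>2 ^ m * x\<rfloor>) \<le> 2 * E"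
    using Lp_norm_lebesgue_on_le[OF p, of "\<lambda>x. g x - a \<lfloor>2 ^ m * x\<rfloor>"] by auto
  define k where "k i = \<lfloor>a (int i) / E\<rfloor>" for i :: nat
  have kB: "k i \<in> {- B..B}" for i
  proof -
    have "\<bar>a (int i)\<bar> \<le> 2 ^ m * 2 ^ l 0"
      using cell_average_bound[OF p, of g "2 ^ m" "int i"] Lp_space_lborel(1)[OF g(2)] gL norm_g
      by (fastforce simp: a_def intro: order_trans)
    then have "\<bar>a (int i) / E\<bar> \<le> of_int B"
      using E by (simp add: B_def E_def abs_mult power_add)
    then have "a (int i) / E \<le> of_int B" "of_int (- B) \<le> a (int i) / E"
      by linarith+
    then show ?thesis
      unfolding k_def by (auto simp: le_floor_iff floor_le_iff)
  qed
  define s where "s = dyadic_step m E k"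
  have sL: "s \<in> Lp_funs p"
    unfolding s_def using kB by (intro dyadic_step_Lp_funs[OF p]) auto
  \<comment> \<open>The rounding error on [0,1). The point 1 is excluded, where \<open>s\<close> is
    0 whatever the average is; it is discarded as a null set below.\<close>
  define w where "w x = (if x \<in> {0..<1} then a \<lfloor>2 ^ m * x\<rfloor> - s x else 0)" for x
  have sM [measurable]: "s \<in> borel_measurable ?M"
    using sL by (simp add: Lp_funs_def)
  have aM [measurable]: "(\<lambda>x. a \<lfloor>2 ^ m * x\<rfloor>) \<in> borel_measurable ?M"
    by (intro measurable_restrict_space1 measurable_completion) simp
  have [measurable]: "{0..<1} \<in> sets ?M"
    by (auto simp: sets_restrict_space_iff)
  have wM: "w \<in> borel_measurable ?M"
    unfolding w_def[abs_def] by measurable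
  have wE: "\<bar>w x\<bar> \<le> E" for x
  proof (cases "x \<in> {0..<1}")
    case True
    let ?j = "\<lfloor>2 ^ m * x\<rfloor>"
    have "w x = a ?j - E * of_int \<lfloor>a ?j / E\<rfloor>"
      using True dyadic_index_less[OF True, of m] by (simp add: w_def s_def dyadic_step_def k_def)
    also have "\<dots> = E * (a ?j / E - of_int \<lfloor>a ?j / E\<rfloor>)"
      using E by (simp add: right_diff_distrib)
    finally have "\<bar>w x\<bar> = E * \<bar>a ?j / E - of_int \<lfloor>a ?j / E\<rfloor>\<bar>"
      using E by (simp add: abs_mult)
    also have "\<dots> \<le> E * 1"
      using E by (intro mult_left_mono) linarith+
    finally show ?thesis by simp
  qed (use E in \<open>auto simp: w_def\<close>)
  have w: "w \<in> Lp_space ?M p" "Lp_norm ?M p w \<le> E * 1 powr (1 / p)"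
    by (rule Lp_norm_bounded_support[OF wM, where A = "{0..1}" and m = 1 and c = E];
        use wE E p in \<open>auto simp: emeasure_restrict_space sets_restrict_space_iff\<close>)+
  have "AE x in lebesgue. x \<noteq> (1::real)"
    by (intro AE_completion AE_lborel_singleton)
  then have "AE x in ?M. g x - s x = (g x - a \<lfloor>2 ^ m * x\<rfloor>) + w x"
    unfolding AE_restrict_space_iff[of "{0..1::real}" lebesgue, simplified]
    by eventually_elim (auto simp: w_def)
  then have "Lp_norm ?M p (\<lambda>x. g x - s x) = Lp_norm ?M p (\<lambda>x. (g x - a \<lfloor>2 ^ m * x\<rfloor>) + w x)"
    using gf sM wM aM by (intro Lp_norm_cong_AE) (auto simp: Lp_funs_def)
  also have "\<dots> \<le> Lp_norm ?M p (\<lambda>x. g x - a \<lfloor>2 ^ m * x\<rfloor>) + Lp_norm ?M p w"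
    using ga w by (intro Lp_norm_triangle[OF p]) (auto simp: Lp_space_def)
  also have "\<dots> \<le> 3 * E"
    using ga(2) w(2) by simp
  also have "\<dots> < 1 / 2 ^ n"
    by (simp add: E_def field_simps)
  finally have "Lp_norm ?M p (\<lambda>x. s x - g x) < 1 / 2 ^ n"
    using Lp_norm_minus_commute[of ?M p s g] by simp
  then have "Lp_dist p (Lp_eq p `` {s}) F < 1 / 2 ^ n"
    using Lp_dist_eq[OF p Lp_class[OF sL] FL g(1)] by simp
  then show ?thesis
    using kB by (intro that[of k]) (auto simp: s_def m_def E_def B_def)
qed

text \<open>Each of the 2^m cells takes one of 2 * 2^N + 1 \<le> 2^(N+2) integer values.\<close>

lemma Lp_modulus_class_cover:
  assumes p: "1 \<le> p"
  obtains C where "finite C" "C \<noteq> {}" "C \<subseteq> Lp p"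
    "card C \<le> 2 ^ ((l (n + 2) + l 0 + n + 4) * 2 ^ l (n + 2))"
    "Lp_modulus_class p l \<subseteq> (\<Union>G\<in>C. Metric_space.mball (Lp p) (Lp_dist p) G (1 / 2 ^ n))"
proof -
  interpret Metric_space "Lp p" "Lp_dist p"
    by (rule Metric_space_Lp[OF p])
  define m where "m = l (n + 2)"
  define N where "N = m + l 0 + n + 2"
  define Q where "Q = {..<2 ^ m :: nat} \<rightarrow>\<^sub>E {- (2 ^ N)..2 ^ N :: int}"
  define c where "c k = Lp_eq p `` {dyadic_step m (1 / 2 ^ (n + 2)) k}" for k
  have Q: "finite Q"
    unfolding Q_def by (intro finite_PiE) auto
  have "(\<lambda>i\<in>{..<2 ^ m}. 0) \<in> Q"
    by (auto simp: Q_def)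
  then have Q0: "Q \<noteq> {}"
    by blast
  have cL: "c k \<in> Lp p" if "k \<in> Q" for k
    unfolding c_def using that
    by (intro Lp_class dyadic_step_Lp_funs[OF p, where B = "2 ^ N"]) (auto simp: Q_def PiE_def Pi_def)
  have "card {- (2 ^ N)..2 ^ N :: int} = 2 * 2 ^ N + 1"
    by (simp add: nat_add_distrib nat_mult_distrib nat_power_eq)
  also have "\<dots> \<le> 2 ^ (N + 2)"
    by simp
  finally have "card Q \<le> (2 ^ (N + 2)) ^ (2 ^ m)"
    unfolding Q_def by (simp only: card_PiE finite_lessThan prod_constant card_lessThan power_mono)
  then have card: "card (c ` Q) \<le> 2 ^ ((N + 2) * 2 ^ m)"
    using card_image_le[OF Q, of c] by (simp only: power_mult order_trans)
  have cover: "Lp_modulus_class p l \<subseteq> (\<Union>G\<in>c ` Q. mball G (1 / 2 ^ n))"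
  proof
    fix F assume F: "F \<in> Lp_modulus_class p l"
    then obtain k where k: "\<And>i. i < 2 ^ m \<Longrightarrow> k i \<in> {- (2 ^ N)..2 ^ N}"
      "Lp_dist p (c k) F < 1 / 2 ^ n"
      using dyadic_step_approx[OF p F, of n] unfolding m_def N_def c_def by blast
    \<comment> \<open>Entries beyond 2^m are never read, so they may be made undefined to land in
      the finite extensional product \<open>Q\<close>.\<close>
    define k' where "k' = restrict k {..<2 ^ m}"
    have "dyadic_step m \<delta> k' = dyadic_step m \<delta> k" for \<delta>
      using dyadic_index_less(2)[of _ m] by (auto simp: dyadic_step_def k'_def)
    then have "c k' = c k"
      by (simp add: c_def)
    moreover have "k' \<in> Q"
      using k(1) by (auto simp: Q_def k'_def)
    moreover have "F \<in> Lp p"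
      using F by (simp add: Lp_modulus_class_def)
    ultimately show "F \<in> (\<Union>G\<in>c ` Q. mball G (1 / 2 ^ n))"
      using k(2) cL[of k'] by (intro UN_I[of "c k'"]) auto
  qed
  show ?thesis
  proof (rule that[of "c ` Q"])
    show "card (c ` Q) \<le> 2 ^ ((l (n + 2) + l 0 + n + 4) * 2 ^ l (n + 2))"
    proof -
      have "N + 2 = l (n + 2) + l 0 + n + 4"
        by (simp add: N_def m_def)
      then show ?thesis
        using card unfolding m_def by metis
    qed
  qed (use Q Q0 cL cover in auto)
qed

section \<open>Upper entropy bound and relative compactness\<close>

lemma metric_entropy_le:
  assumes "finite C" "C \<noteq> {}" "C \<subseteq> M" "card C \<le> 2 ^ k"
    "K \<subseteq> (\<Union>x\<in>C. Metric_space.mball M d x (1 / 2 ^ n))"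
  shows "metric_entropy M d K n \<le> enat k"
proof -
  obtain b where b: "bij_betw b {0..<card C} C"
    using ex_bij_betw_nat_finite[OF assms(1)] by blast
  obtain x0 where "x0 \<in> C"
    using assms(2) by blast
  \<comment> \<open>The definition of entropy asks for exactly 2^k indexed centres, so the
    enumeration of \<open>C\<close> is padded with repetitions of \<open>x0\<close>.\<close>
  define c where "c i = (if i < card C then b i else x0)" for i
  have c: "c i \<in> C" for i
    using b \<open>x0 \<in> C\<close> by (auto simp: c_def bij_betw_def)
  have "C \<subseteq> c ` {..<2 ^ k}"
  proof
    fix x assume "x \<in> C"
    then obtain i where "i < card C" "x = b i"
      using b unfolding bij_betw_def by force
    then show "x \<in> c ` {..<2 ^ k}"
      using assms(4) by (auto simp: c_def intro!: image_eqI[of _ _ i])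
  qed
  then have "K \<subseteq> (\<Union>i<2 ^ k. Metric_space.mball M d (c i) (1 / 2 ^ n))"
    using assms(5) by blast
  then show ?thesis
    unfolding metric_entropy_def using c assms(3) by (intro Inf_lower) blast
qed

text \<open>The covering has 2^k balls with k = x * 2^l(n+2) and x = l(n+2) + l(0) + n + 4. Since x
  < 2^x, the second-order polynomial x + l(n+2) serves as exponent.\<close>

lemma metric_entropy_upper:
  assumes p: "1 \<le> p"
  shows "\<exists>P. second_order_poly P \<and>
    (\<forall>l n. metric_entropy (Lp p) (Lp_dist p) (Lp_modulus_class p l) n \<le> enat (2 ^ P l n))"
proof -
  \<comment> \<open>The building blocks n + c and 0, in the literal shape of the polynomial base
    case.\<close>
  define q where "q c = (\<lambda>(l :: nat \<Rightarrow> nat) n. nat (poly [:int c, 1:] (int n)))" for c :: nat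
  define z where "z = (\<lambda>(l :: nat \<Rightarrow> nat) n. nat (poly 0 (int n)))"
  have q: "second_order_poly (q c)" for c
    unfolding q_def by (rule second_order_poly.of_poly) simp
  have z: "second_order_poly z"
    unfolding z_def by (rule second_order_poly.of_poly) simp
  define P where "P = (\<lambda>l n. l (q 2 l n) + (l (q 2 l n) + (l (z l n) + q 4 l n)))"
  have "second_order_poly P"
    unfolding P_def by (intro second_order_poly.intros q z)
  moreover have "metric_entropy (Lp p) (Lp_dist p) (Lp_modulus_class p l) n \<le> enat (2 ^ P l n)" for l n
  proof -
    let ?k = "(l (n + 2) + l 0 + n + 4) * 2 ^ l (n + 2)"
    obtain C where C: "finite C" "C \<noteq> {}" "C \<subseteq> Lp p" "card C \<le> 2 ^ ?k"
      "Lp_modulus_class p l \<subseteq> (\<Union>G\<in>C. Metric_space.mball (Lp p) (Lp_dist p) G (1 / 2 ^ n))"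
      using Lp_modulus_class_cover[OF p] .
    have "nat (2 + int n) = n + 2" "nat (4 + int n) = n + 4"
      by linarith+
    then have P: "P l n = (l (n + 2) + l 0 + n + 4) + l (n + 2)"
      by (simp add: P_def q_def z_def)
    have "?k \<le> 2 ^ (l (n + 2) + l 0 + n + 4) * 2 ^ l (n + 2)"
      by (intro mult_right_mono less_imp_le less_exp) simp
    also have "\<dots> = 2 ^ P l n"
      unfolding P by (simp only: power_add)
    finally show ?thesis
      using metric_entropy_le[OF C] by (meson enat_ord_simps(1) order_trans)
  qed
  ultimately show ?thesis by blast
qed

text \<open>In a complete space a set is relatively compact iff it is totally bounded. Total
  boundedness wants centres in K, while the step functions need not belong to K.\<close>

lemma relatively_compact_iff_modulus:
  assumes p: "1 \<le> p" and K: "K \<subseteq> Lp p"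
  shows "relatively_compactin (Metric_space.mtopology (Lp p) (Lp_dist p)) K \<longleftrightarrow>
    (\<exists>l. K \<subseteq> Lp_modulus_class p l)"
proof -
  interpret Metric_space "Lp p" "Lp_dist p"
    by (rule Metric_space_Lp[OF p])
  have "relatively_compactin mtopology K \<longleftrightarrow> mtotally_bounded K"
    using mtotally_bounded_eq_compact_closure_of[OF mcomplete_Lp[OF p], of K] K
    by (auto simp: relatively_compactin_def)
  also have "\<dots> \<longleftrightarrow> (\<exists>l. K \<subseteq> Lp_modulus_class p l)"
  proof
    assume "\<exists>l. K \<subseteq> Lp_modulus_class p l"
    then obtain l where l: "K \<subseteq> Lp_modulus_class p l" ..
    have "\<exists>C'. finite C' \<and> C' \<subseteq> K \<and> K \<subseteq> (\<Union>x\<in>C'. mball x e)" if "0 < e" for e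
    proof -
      \<comment> \<open>Half of e, because moving each centre into K doubles the radius.\<close>
      obtain n where n: "(1 / 2) ^ n < e / 2"
        using real_arch_pow_inv[of "e / 2" "1 / 2"] \<open>0 < e\<close> by auto
      obtain C where C: "finite C" "C \<subseteq> Lp p" "Lp_modulus_class p l \<subseteq> (\<Union>G\<in>C. mball G (1 / 2 ^ n))"
        using Lp_modulus_class_cover[OF p, of l n] by metis
      \<comment> \<open>Only balls that meet K can be recentred at a point of K.\<close>
      define D where "D = {G \<in> C. K \<inter> mball G (1 / 2 ^ n) \<noteq> {}}"
      have "\<forall>G\<in>D. \<exists>F. F \<in> K \<and> F \<in> mball G (1 / 2 ^ n)"
        by (auto simp: D_def)
      then obtain \<phi> where \<phi>: "\<And>G. G \<in> D \<Longrightarrow> \<phi> G \<in> K \<and> \<phi> G \<in> mball G (1 / 2 ^ n)"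
        by metis
      have "K \<subseteq> (\<Union>x\<in>\<phi> ` D. mball x e)"
      proof
        fix F assume F: "F \<in> K"
        then obtain G where G: "G \<in> C" "F \<in> mball G (1 / 2 ^ n)"
          using C l by blast
        then have GD: "G \<in> D"
          using F by (auto simp: D_def)
        note \<phi>[OF GD]
        moreover have "Lp_dist p (\<phi> G) F \<le> Lp_dist p (\<phi> G) G + Lp_dist p G F"
          using G \<phi>[OF GD] by (intro triangle) auto
        ultimately have "Lp_dist p (\<phi> G) F < (1 / 2) ^ n + (1 / 2) ^ n"
          using G by (auto simp: commute power_one_over)
        then have "Lp_dist p (\<phi> G) F < e"
          using n by linarith
        then show "F \<in> (\<Union>x\<in>\<phi> ` D. mball x e)"
          using GD \<phi>[OF GD] G by auto
      qed
      moreover have "finite (\<phi> ` D)" "\<phi> ` D \<subseteq> K"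
        using C \<phi> by (auto simp: D_def)
      ultimately show ?thesis by blast
    qed
    then show "mtotally_bounded K"
      by (simp add: mtotally_bounded_def)
  qed (rule mtotally_bounded_imp_modulus[OF p])
  finally show ?thesis .
qed

section \<open>Lower bound by signed tents\<close>

text \<open>A triangle wave: on the cell from j to j + 1 it is a tent with value \<sigma> j at the
  midpoint and 0 at both ends.\<close>

definition tent_wave :: "(int \<Rightarrow> real) \<Rightarrow> real \<Rightarrow> real" where
  "tent_wave \<sigma> y = \<sigma> \<lfloor>y\<rfloor> * (1 - \<bar>2 * frac y - 1\<bar>)"

text \<open>Within a cell the slope is at most 2. For points of different cells each value is at
  most twice the distance to the end of its cell facing the other point, and these distances add up
  to at most |x - y|.\<close>

lemma tent_wave_lipschitz:
  assumes "\<And>j. \<bar>\<sigma> j\<bar> \<le> 1"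
  shows "\<bar>tent_wave \<sigma> x - tent_wave \<sigma> y\<bar> \<le> 2 * \<bar>x - y\<bar>"
proof (induction x y rule: linorder_wlog)
  case (le x y)
  let ?T = "\<lambda>z :: real. 1 - \<bar>2 * frac z - 1\<bar>"
  have T: "0 \<le> ?T z" "?T z \<le> 2 * frac z" "?T z \<le> 2 * (1 - frac z)" for z
    using frac_ge_0[of z] frac_lt_1[of z] by (auto simp: abs_if)
  have W: "\<bar>tent_wave \<sigma> z\<bar> \<le> ?T z" for z
    using mult_mono[OF assms[of "\<lfloor>z\<rfloor>"] order_refl[of "?T z"]] T(1)[of z]
    by (simp add: tent_wave_def abs_mult)
  show ?case
  proof (cases "\<lfloor>x\<rfloor> = \<lfloor>y\<rfloor>")
    case True
    then have "frac x - frac y = x - y"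
      by (simp add: frac_def)
    then have "(2 * frac y - 1) - (2 * frac x - 1) = 2 * (y - x)"
      by simp
    then have "\<bar>?T x - ?T y\<bar> \<le> \<bar>2 * (y - x)\<bar>"
      using abs_triangle_ineq3[of "2 * frac y - 1" "2 * frac x - 1"] by simp
    then have "\<bar>?T x - ?T y\<bar> \<le> 2 * \<bar>x - y\<bar>"
      by (simp only: abs_mult abs_minus_commute[of y x] abs_numeral)
    moreover have "tent_wave \<sigma> x - tent_wave \<sigma> y = \<sigma> \<lfloor>x\<rfloor> * (?T x - ?T y)"
      using True by (simp add: tent_wave_def algebra_simps)
    moreover have "\<bar>\<sigma> \<lfloor>x\<rfloor>\<bar> * \<bar>?T x - ?T y\<bar> \<le> 1 * \<bar>?T x - ?T y\<bar>"
      by (intro mult_right_mono assms) simp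
    ultimately show ?thesis
      by (simp add: abs_mult)
  next
    case False
    then have "\<lfloor>x\<rfloor> + 1 \<le> \<lfloor>y\<rfloor>"
      using floor_mono[OF le] by linarith
    then have "real_of_int \<lfloor>x\<rfloor> + 1 \<le> real_of_int \<lfloor>y\<rfloor>"
      by linarith
    then have "2 * (1 - frac x) + 2 * frac y \<le> 2 * \<bar>x - y\<bar>"
      using le by (simp add: frac_def)
    then show ?thesis
      using W[of x] W[of y] T(3)[of x] T(2)[of y] by linarith
  qed
next
  case (sym x y)
  then show ?case by (simp add: abs_minus_commute)
qed

lemma tent_wave_bound:
  assumes "\<And>j. \<bar>\<sigma> j\<bar> \<le> 1"
  shows "\<bar>tent_wave \<sigma> y\<bar> \<le> 1"
proof -
  have "\<bar>1 - \<bar>2 * frac y - 1\<bar>\<bar> \<le> 1"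
    using frac_ge_0[of y] frac_lt_1[of y] by linarith
  then show ?thesis
    using mult_mono[OF assms[of "\<lfloor>y\<rfloor>"]] by (fastforce simp: tent_wave_def abs_mult)
qed

lemma tent_wave_measurable [measurable]: "tent_wave \<sigma> \<in> borel_measurable borel"
proof -
  have [measurable]: "(\<lambda>y::real. \<sigma> \<lfloor>y\<rfloor>) \<in> borel_measurable borel"
    by (rule measurable_compose[of floor _ "count_space UNIV"]) measurable
  show ?thesis
    unfolding tent_wave_def[abs_def] frac_def by measurable
qed

text \<open>At the right end the floor jumps to j + 1, but both sides vanish there. The closed cell
  is what the integral over closed intervals needs.\<close>

lemma tent_wave_cell:
  assumes "y \<in> {of_int j..of_int j + 1}"
  shows "tent_wave \<sigma> y = \<sigma> j * (1 - \<bar>2 * (y - of_int j) - 1\<bar>)"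
proof (cases "y = of_int j + 1")
  case True
  then have "y = of_int (j + 1)" by simp
  then have "frac y = 0" by (metis frac_of_int)
  then show ?thesis using True by (simp add: tent_wave_def)
next
  case False
  then have "\<lfloor>y\<rfloor> = j"
    using assms by (auto simp: floor_eq_iff)
  then show ?thesis by (simp add: tent_wave_def frac_def)
qed

lemma tent_wave_integral_cell:
  assumes N: "0 < (N::real)"
  shows "((\<lambda>x. \<bar>tent_wave \<sigma> (N * x)\<bar>) has_integral (\<bar>\<sigma> j\<bar> / (2 * N))) {of_int j / N..(of_int j + 1) / N}"
proof -
  let ?a = "of_int j / N" and ?b = "(of_int j + 1 / 2) / N" and ?c = "(of_int j + 1) / N"
  \<comment> \<open>Antiderivatives of the rising and of the falling half of the tent; together they
    give the area of a triangle with base 1 / N and height |\<sigma> j|.\<close>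
  let ?F = "\<lambda>x. \<bar>\<sigma> j\<bar> * ((N * x - of_int j)\<^sup>2 / N)"
  let ?G = "\<lambda>x. \<bar>\<sigma> j\<bar> * (- ((N * x - of_int j - 1)\<^sup>2 / N))"
  have "((\<lambda>x. \<bar>\<sigma> j\<bar> * (2 * (N * x - of_int j))) has_integral (?F ?b - ?F ?a)) {?a..?b}"
    using N by (intro fundamental_theorem_of_calculus)
      (auto intro!: derivative_eq_intros divide_right_mono simp flip: has_real_derivative_iff_has_vector_derivative)
  then have 1: "((\<lambda>x. \<bar>tent_wave \<sigma> (N * x)\<bar>) has_integral (?F ?b - ?F ?a)) {?a..?b}"
  proof (rule has_integral_eq[rotated])
    fix x assume "x \<in> {?a..?b}"
    then have x: "of_int j \<le> N * x" "N * x \<le> of_int j + 1 / 2"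
      using N by (auto simp: field_simps)
    then show "\<bar>\<sigma> j\<bar> * (2 * (N * x - of_int j)) = \<bar>tent_wave \<sigma> (N * x)\<bar>"
      by (subst tent_wave_cell[of _ j]) (auto simp: abs_mult)
  qed
  have "((\<lambda>x. \<bar>\<sigma> j\<bar> * (- (2 * (N * x - of_int j - 1)))) has_integral (?G ?c - ?G ?b)) {?b..?c}"
  proof (rule fundamental_theorem_of_calculus)
    show "?b \<le> ?c"
      using N by (simp add: divide_right_mono)
    show "(?G has_vector_derivative \<bar>\<sigma> j\<bar> * (- (2 * (N * x - of_int j - 1)))) (at x within {?b..?c})" for x
      unfolding has_real_derivative_iff_has_vector_derivative[symmetric]
      using N by (auto intro!: derivative_eq_intros) (simp add: algebra_simps)
  qed
  then have 2: "((\<lambda>x. \<bar>tent_wave \<sigma> (N * x)\<bar>) has_integral (?G ?c - ?G ?b)) {?b..?c}"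
  proof (rule has_integral_eq[rotated])
    fix x assume "x \<in> {?b..?c}"
    then have x: "of_int j + 1 / 2 \<le> N * x" "N * x \<le> of_int j + 1"
      using N by (auto simp: field_simps)
    then show "\<bar>\<sigma> j\<bar> * (- (2 * (N * x - of_int j - 1))) = \<bar>tent_wave \<sigma> (N * x)\<bar>"
      by (subst tent_wave_cell[of _ j]) (auto simp: abs_mult)
  qed
  have "((\<lambda>x. \<bar>tent_wave \<sigma> (N * x)\<bar>) has_integral ((?F ?b - ?F ?a) + (?G ?c - ?G ?b))) {?a..?c}"
    using N by (intro has_integral_combine[OF _ _ 1 2]) (auto simp: divide_right_mono)
  moreover have "(?F ?b - ?F ?a) + (?G ?c - ?G ?b) = \<bar>\<sigma> j\<bar> / (2 * N)"
    using N by (simp add: power2_eq_square field_simps)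
  ultimately show ?thesis by simp
qed

lemma tent_wave_integral:
  assumes N: "0 < (N::nat)"
  shows "((\<lambda>x. \<bar>tent_wave \<sigma> (real N * x)\<bar>) has_integral (\<Sum>j<N. \<bar>\<sigma> (int j)\<bar>) / (2 * real N)) {0..1}"
proof -
  have "((\<lambda>x. \<bar>tent_wave \<sigma> (real N * x)\<bar>) has_integral (\<Sum>j<k. \<bar>\<sigma> (int j)\<bar>) / (2 * real N)) {0..real k / real N}"
    for k
  proof (induction k)
    case (Suc k)
    have "((\<lambda>x. \<bar>tent_wave \<sigma> (real N * x)\<bar>) has_integral (\<bar>\<sigma> (int k)\<bar> / (2 * real N)))
        {real k / real N..real (Suc k) / real N}"
      using tent_wave_integral_cell[of "real N" \<sigma> "int k"] N by (simp add: add.commute)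
    from has_integral_combine[OF _ _ Suc this] show ?case
      using N by (simp add: divide_right_mono add_divide_distrib)
  qed (simp add: has_integral_refl)
  from this[of N] show ?thesis
    using N by simp
qed

text \<open>S lists the cells with positive sign. Coefficients vanish outside the N cells, so the
  function is its own extension by zero, and the Hamming distance of two sign patterns is the size
  of the symmetric difference of their sets.\<close>

definition sign_wave :: "nat \<Rightarrow> real \<Rightarrow> nat set \<Rightarrow> real \<Rightarrow> real" where
  "sign_wave N a S x =
     a * tent_wave (\<lambda>j. if 0 \<le> j \<and> j < int N then (if nat j \<in> S then 1 else - 1) else 0) (real N * x)"

lemma sign_wave_zero:
  assumes "0 < N" "x \<notin> {0..1}"
  shows "sign_wave N a S x = 0"
proof -
  have "\<not> (0 \<le> \<lfloor>real N * x\<rfloor> \<and> \<lfloor>real N * x\<rfloor> < int N)"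
  proof
    assume "0 \<le> \<lfloor>real N * x\<rfloor> \<and> \<lfloor>real N * x\<rfloor> < int N"
    then have "0 \<le> real N * x" "real N * x < real N * 1"
      by (auto simp: floor_less_iff)
    then have "0 \<le> x" "x < 1"
      using assms(1) by (auto simp: zero_le_mult_iff)
    then show False using assms(2) by simp
  qed
  then show ?thesis
    by (auto simp: sign_wave_def tent_wave_def)
qed

lemma zero_ext_sign_wave: "0 < N \<Longrightarrow> zero_ext (sign_wave N a S) = sign_wave N a S"
  using sign_wave_zero by (fastforce simp: zero_ext_def)

lemma sign_wave_bound:
  assumes "0 \<le> a"
  shows "\<bar>sign_wave N a S x\<bar> \<le> a"
  unfolding sign_wave_def abs_mult
  using mult_left_mono[OF tent_wave_bound, of _ a] assms by simp

lemma sign_wave_lipschitz: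
  assumes "0 \<le> a"
  shows "\<bar>sign_wave N a S x - sign_wave N a S y\<bar> \<le> 2 * a * real N * \<bar>x - y\<bar>"
proof -
  let ?\<sigma> = "\<lambda>j. if 0 \<le> j \<and> j < int N then (if nat j \<in> S then 1 else - 1) else (0::real)"
  have "\<bar>sign_wave N a S x - sign_wave N a S y\<bar> = a * \<bar>tent_wave ?\<sigma> (real N * x) - tent_wave ?\<sigma> (real N * y)\<bar>"
    using assms by (simp add: sign_wave_def abs_mult flip: right_diff_distrib)
  also have "\<dots> \<le> a * (2 * \<bar>real N * x - real N * y\<bar>)"
    using assms by (intro mult_left_mono tent_wave_lipschitz) auto
  also have "\<bar>real N * x - real N * y\<bar> = real N * \<bar>x - y\<bar>"
    by (simp add: abs_mult flip: right_diff_distrib)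
  finally show ?thesis by (simp add: mult.assoc)
qed

lemma sign_wave_measurable [measurable]: "sign_wave N a S \<in> borel_measurable borel"
  unfolding sign_wave_def[abs_def] by measurable

lemma sign_wave_Lp:
  assumes p: "1 \<le> p" and a: "0 \<le> a" and N: "0 < N"
  shows "sign_wave N a S \<in> Lp_space lebesgue p" "Lp_norm lebesgue p (sign_wave N a S) \<le> a"
    "sign_wave N a S \<in> Lp_funs p"
proof -
  have m: "sign_wave N a S \<in> borel_measurable lebesgue"
    by (intro measurable_completion) simp
  have *: "sign_wave N a S \<in> Lp_space lebesgue p \<and> Lp_norm lebesgue p (sign_wave N a S) \<le> a * 1 powr (1 / p)"
    by (intro conjI; rule Lp_norm_bounded_support[OF m, where A = "{0..1}" and m = 1];
        use p a sign_wave_bound sign_wave_zero[OF N] in auto)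
  then show "sign_wave N a S \<in> Lp_space lebesgue p" "Lp_norm lebesgue p (sign_wave N a S) \<le> a"
    by auto
  then show "sign_wave N a S \<in> Lp_funs p"
    using Lp_norm_lebesgue_on_le(1)[OF p] by (simp add: Lp_funs_eq)
qed

text \<open>The Lipschitz bound holds on [0,1] enlarged by the shift, of length 1 + |h|. As this is
  at least 1, its power 1 / p is bounded by itself.\<close>

lemma sign_wave_shift:
  assumes p: "1 \<le> p" and a: "0 \<le> a" and N: "0 < N"
  shows "Lp_norm lebesgue p (\<lambda>x. sign_wave N a S x - translate h (sign_wave N a S) x)
    \<le> 2 * a * real N * \<bar>h\<bar> * (1 + \<bar>h\<bar>)"
proof -
  let ?f = "sign_wave N a S"
  have m: "(\<lambda>x. ?f x - translate h ?f x) \<in> borel_measurable lebesgue"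
    unfolding translate_def by (intro measurable_completion) measurable
  have "Lp_norm lebesgue p (\<lambda>x. ?f x - translate h ?f x)
      \<le> 2 * a * real N * \<bar>h\<bar> * (1 + \<bar>h\<bar>) powr (1 / p)"
  proof (rule Lp_norm_bounded_support[OF m, where A = "{min 0 (- h)..max 1 (1 - h)}"])
    show "emeasure lebesgue {min 0 (- h)..max 1 (1 - h)} \<le> ennreal (1 + \<bar>h\<bar>)"
      by (simp add: min_def max_def ennreal_leI del: ennreal_plus)
    show "?f x - translate h ?f x = 0" if "x \<notin> {min 0 (- h)..max 1 (1 - h)}" for x
      using that by (auto simp: translate_def sign_wave_zero[OF N] min_def max_def split: if_splits)
    show "\<bar>?f x - translate h ?f x\<bar> \<le> 2 * a * real N * \<bar>h\<bar>" for x
      using sign_wave_lipschitz[OF a, of N S x "x + h"] by (simp add: translate_def)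
  qed (use p a in \<open>auto simp: min_def max_def\<close>)
  also have "(1 + \<bar>h\<bar>) powr (1 / p) \<le> (1 + \<bar>h\<bar>) powr 1"
    using p by (intro powr_mono) auto
  finally show ?thesis
    using a by (simp add: mult_left_mono)
qed

text \<open>The difference is again a tent wave, with coefficients 0 or \<plusminus>2, nonzero
  exactly on the symmetric difference. Its L^1 norm is computed exactly and bounds the L^p norm from
  below.\<close>

lemma sign_wave_distance:
  assumes p: "1 \<le> p" and a: "0 \<le> a" and N: "0 < N" and S: "S \<subseteq> {..<N}" "T \<subseteq> {..<N}"
  shows "a * real (card (S - T \<union> (T - S))) / real N
    \<le> Lp_norm (lebesgue_on {0..1}) p (\<lambda>x. sign_wave N a S x - sign_wave N a T x)"
proof -
  let ?D = "S - T \<union> (T - S)"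
  let ?u = "\<lambda>x. sign_wave N a S x - sign_wave N a T x"
  define \<sigma> where "\<sigma> j = (if 0 \<le> j \<and> j < int N then (if nat j \<in> S then 1 else - 1) else (0::real))
      - (if 0 \<le> j \<and> j < int N then (if nat j \<in> T then 1 else - 1) else 0)" for j
  have u: "?u \<in> Lp_space (lebesgue_on {0..1}) p"
    using sign_wave_Lp(3)[OF p a N] p by (intro Lp_space_diff) (auto simp: Lp_funs_eq)
  have u_eq: "\<bar>?u x\<bar> = a * \<bar>tent_wave \<sigma> (real N * x)\<bar>" for x
  proof -
    have "?u x = a * tent_wave \<sigma> (real N * x)"
      unfolding sign_wave_def tent_wave_def \<sigma>_def by (simp add: algebra_simps)
    then show ?thesis using a by (simp add: abs_mult)
  qed
  have "(\<Sum>j<N. \<bar>\<sigma> (int j)\<bar>) = (\<Sum>j<N. if j \<in> ?D then 2 else 0)"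
    by (intro sum.cong) (auto simp: \<sigma>_def)
  also have "\<dots> = 2 * real (card ?D)"
    using S by (subst sum.If_cases) (auto intro!: arg_cong[of _ _ card])
  finally have "((\<lambda>x. a * \<bar>tent_wave \<sigma> (real N * x)\<bar>) has_integral a * (2 * real (card ?D) / (2 * real N))) {0..1}"
    using has_integral_mult_right[OF tent_wave_integral[OF N, of \<sigma>], of a] by simp
  then have "integral {0..1} (\<lambda>x. \<bar>?u x\<bar>) = a * real (card ?D) / real N"
    unfolding u_eq by (subst integral_unique) auto
  moreover have "integrable (lebesgue_on {0..1}) (\<lambda>x. \<bar>?u x\<bar>)"
    using L1_le_Lp_norm(1)[OF p u] by simp
  ultimately show ?thesis
    using L1_le_Lp_norm(2)[OF p u] by (simp add: lebesgue_integral_eq_integral)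
qed

section \<open>Moduli of the sign waves\<close>

lemma modulus_growth_ge:
  assumes "modulus_growth l" "l i \<noteq> 0"
  shows "l i + j \<le> l (i + j)"
proof (induction j)
  case (Suc j)
  then have "l (i + j) \<noteq> 0"
    using assms(2) by linarith
  then have "l (i + j) < l (i + j + 1)"
    using assms(1) by (simp add: modulus_growth_def)
  then show ?case
    using Suc by simp
qed simp

text \<open>Height and frequency are balanced so that the slope \<open>2 a N = a 2\<^sup>L\<close> is just admissible at scale
  \<open>2\<^sup>-\<^sup>L\<close>; the factor \<open>8 / 9\<close> leaves room for the boundary term \<open>1 + \<bar>h\<bar>\<close>.\<close>

lemma sign_wave_modulus:
  assumes p: "1 \<le> p" and l: "modulus_growth l" and n: "3 \<le> n" and L: "9 \<le> l (n - 3)"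
  shows "Lp_modulus p l (sign_wave (2 ^ (l (n - 3) - 1)) (8 / 9 * (1 / 2 ^ (n - 3))) S)"
proof -
  define L where "L = l (n - 3)"
  define e where "e = (1 / 2 ^ (n - 3) :: real)"
  define a where "a = 8 / 9 * e"
  define N where "N = (2 ^ (L - 1) :: nat)"
  let ?f = "sign_wave N a S"
  have a: "0 \<le> a" and N: "0 < N" and e: "0 < e"
    by (auto simp: a_def e_def N_def)
  have "2 * (2::real) ^ (L - 1) = 2 ^ L"
    using L by (simp add: L_def flip: power_Suc)
  then have NL: "2 * real N = 2 ^ L"
    by (simp add: N_def)
  have "Lp_norm lebesgue p (\<lambda>x. ?f x - translate h ?f x) < 1 / 2 ^ m"
    if h: "\<bar>h\<bar> \<le> 1 / 2 ^ l m" for m h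
  \<comment> \<open>At coarse scales the height alone suffices, through twice the norm. At fine
    scales the growth condition gives l(m) \<ge> L + j, so the Lipschitz bound gains the factor 2^-j
    that is required.\<close>
  proof (cases "m < n - 3")
    case True
    have "Lp_norm lebesgue p (\<lambda>x. ?f x - translate h ?f x) \<le> 2 * Lp_norm lebesgue p ?f"
      using Lp_norm_shift_le[OF p sign_wave_Lp(1)[OF p a N], of "\<lambda>_. 0" S h] p
      by (simp add: Lp_space_def translate_def Lp_norm_def)
    also have "\<dots> \<le> 2 * a"
      using sign_wave_Lp(2)[OF p a N] by simp
    also have "\<dots> < 2 * e"
      using e by (simp add: a_def)
    also have "\<dots> = 2 / 2 ^ (n - 3)"
      by (simp add: e_def)
    also have "\<dots> \<le> 2 / 2 ^ (m + 1)"
      using True by (intro divide_left_mono power_increasing) auto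
    finally show ?thesis by simp
  next
    case False
    define j where "j = m - (n - 3)"
    have m: "m = n - 3 + j"
      using False by (simp add: j_def)
    have "L + j \<le> l m"
      using modulus_growth_ge[OF l, of "n - 3" j] L unfolding m L_def by simp
    then have "(1::real) / 2 ^ l m \<le> 1 / 2 ^ (L + j)"
      by (intro divide_left_mono power_increasing) auto
    then have h1: "\<bar>h\<bar> \<le> 1 / 2 ^ (L + j)"
      using h by linarith
    \<comment> \<open>This is where L \<ge> 9 enters: (8/9) * (513/512) = 57/64 < 1.\<close>
    also have "\<dots> \<le> 1 / 2 ^ 9"
      using L by (intro divide_left_mono power_increasing) (auto simp: L_def)
    finally have h2: "1 + \<bar>h\<bar> \<le> 513 / 512"
      by simp
    have "Lp_norm lebesgue p (\<lambda>x. ?f x - translate h ?f x) \<le> 2 * a * real N * \<bar>h\<bar> * (1 + \<bar>h\<bar>)"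
      by (rule sign_wave_shift[OF p a N])
    also have "\<dots> = a * 2 ^ L * \<bar>h\<bar> * (1 + \<bar>h\<bar>)"
      using NL by (simp add: mult.commute mult.left_commute)
    also have "\<dots> \<le> a * 2 ^ L * (1 / 2 ^ (L + j)) * (513 / 512)"
      using a h1 h2 by (intro mult_mono) auto
    also have "\<dots> = a / 2 ^ j * (513 / 512)"
      by (simp add: power_add)
    also have "\<dots> < e / 2 ^ j"
      using e by (simp add: a_def field_simps)
    also have "\<dots> = 1 / 2 ^ m"
      by (simp add: e_def m power_add)
    finally show ?thesis .
  qed
  then show ?thesis
    using l zero_ext_sign_wave[OF N, of a S] unfolding Lp_modulus_def a_def N_def e_def L_def by simp
qed

section \<open>Counting sign patterns by Hamming balls\<close>

lemma card_Pow_bounded_le: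
  assumes "finite A"
  shows "real (card {U. U \<subseteq> A \<and> card U \<le> t}) \<le> 2 ^ t * (3 / 2) ^ card A"
proof -
  have "real (card {U. U \<subseteq> A \<and> card U \<le> t}) = (\<Sum>U\<in>{U. U \<subseteq> A \<and> card U \<le> t}. 1)"
    by simp
  \<comment> \<open>A Chernoff weight: 2^(t - |U|) is at least 1 on the sets counted, and its sum
    over all subsets factors into a product.\<close>
  also have "\<dots> \<le> (\<Sum>U\<in>{U. U \<subseteq> A \<and> card U \<le> t}. 2 ^ t * (1 / 2) ^ card U)"
  proof (rule sum_mono)
    fix U assume "U \<in> {U. U \<subseteq> A \<and> card U \<le> t}"
    then have "(2::real) ^ card U \<le> 2 ^ t"
      by (intro power_increasing) auto
    then show "(1::real) \<le> 2 ^ t * (1 / 2) ^ card U"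
      by (simp add: power_one_over field_simps)
  qed
  also have "\<dots> \<le> (\<Sum>U\<in>Pow A. 2 ^ t * (1 / 2) ^ card U)"
    using assms by (intro sum_mono2) auto
  also have "\<dots> = 2 ^ t * (\<Sum>U\<in>Pow A. (1 / 2) ^ card U)"
    by (simp add: sum_distrib_left)
  also have "(\<Sum>U\<in>Pow A. (1 / 2 :: real) ^ card U) = (\<Prod>i\<in>A. 1 / 2 + 1)"
    using assms by (subst prod_add) auto
  finally show ?thesis by simp
qed

text \<open>In dimension \<open>32 r\<close> a Hamming ball of radius \<open>9 r\<close> has at most \<open>2\<^bsup>28 r\<^esup>\<close> points because
  \<open>3\<^bsup>32\<^esup> \<le> 2\<^bsup>51\<^esup>\<close>.\<close>

lemma hamming_covering_bound:
  assumes cover: "\<And>S. S \<subseteq> {..<32 * r} \<Longrightarrow> \<iota> S < (2::nat) ^ k"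
    and close: "\<And>S T. S \<subseteq> {..<32 * r} \<Longrightarrow> T \<subseteq> {..<32 * r} \<Longrightarrow> \<iota> S = \<iota> T \<Longrightarrow>
      card (S - T \<union> (T - S)) \<le> 9 * r"
  shows "4 * r \<le> k"
proof -
  let ?A = "{..<32 * r}"
  define V where "V = card {U. U \<subseteq> ?A \<and> card U \<le> 9 * r}"
  \<comment> \<open>Symmetric difference with a fixed member S maps a fibre injectively into the
    Hamming ball around the empty set.\<close>
  have fib: "card {S. S \<subseteq> ?A \<and> \<iota> S = i} \<le> V" for i
  proof (cases "\<exists>S. S \<subseteq> ?A \<and> \<iota> S = i")
    case True
    then obtain S where S: "S \<subseteq> ?A" "\<iota> S = i" by blast
    show ?thesis
      unfolding V_def
    proof (rule card_inj_on_le[where f = "\<lambda>T. S - T \<union> (T - S)"])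
      show "inj_on (\<lambda>T. S - T \<union> (T - S)) {S. S \<subseteq> ?A \<and> \<iota> S = i}"
        by (auto simp: inj_on_def)
      show "(\<lambda>T. S - T \<union> (T - S)) ` {S. S \<subseteq> ?A \<and> \<iota> S = i} \<subseteq> {U. U \<subseteq> ?A \<and> card U \<le> 9 * r}"
        using S close by blast
    qed simp
  next
    case False
    then have "{S. S \<subseteq> ?A \<and> \<iota> S = i} = {}" by blast
    then show ?thesis by (simp only: card.empty)
  qed
  have "Pow ?A = (\<Union>i<2 ^ k. {S. S \<subseteq> ?A \<and> \<iota> S = i})"
    using cover by auto
  then have "2 ^ (32 * r) \<le> (\<Sum>i<2 ^ k. card {S. S \<subseteq> ?A \<and> \<iota> S = i})"
    using card_UN_le[of "{..<2 ^ k}" "\<lambda>i. {S. S \<subseteq> ?A \<and> \<iota> S = i}"] card_Pow[of ?A] by simp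
  also have "\<dots> \<le> 2 ^ k * V"
    using sum_bounded_above[of "{..<2 ^ k}" "\<lambda>i. card {S. S \<subseteq> ?A \<and> \<iota> S = i}" V] fib by simp
  finally have "2 ^ (32 * r) \<le> 2 ^ k * V" .
  then have "real (2 ^ (32 * r)) \<le> real (2 ^ k * V)"
    by (rule of_nat_mono)
  then have "(2::real) ^ (32 * r) \<le> 2 ^ k * real V"
    by simp
  also have "\<dots> \<le> 2 ^ k * (2 ^ (9 * r) * (3 / 2) ^ (32 * r))"
    using card_Pow_bounded_le[of ?A "9 * r"] by (intro mult_left_mono) (auto simp: V_def)
  also have "\<dots> = 2 ^ k * (2 ^ 9 * (3 / 2) ^ 32) ^ r"
    by (simp add: power_mult power_mult_distrib)
  also have "\<dots> \<le> 2 ^ k * (2 ^ 28) ^ r"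
    by (intro mult_left_mono power_mono) (simp_all add: power_divide)
  also have "\<dots> = 2 ^ (k + 28 * r)"
    by (simp add: power_add power_mult)
  finally have "32 * r \<le> k + 28 * r"
    by (subst (asm) power_increasing_iff) auto
  then show ?thesis by simp
qed

text \<open>Each sign pattern is assigned a centre whose ball contains its function. Patterns
  sharing a centre are close in norm, hence in Hamming distance, so the counting bound limits the
  fibres.\<close>

lemma metric_entropy_lower:
  assumes p: "1 \<le> p" and l: "modulus_growth l" and n: "3 \<le> n" and L9: "9 \<le> l (n - 3)"
  shows "enat (2 ^ (l (n - 3) - 4)) \<le> metric_entropy (Lp p) (Lp_dist p) (Lp_modulus_class p l) n"
  unfolding metric_entropy_def
proof (rule Inf_greatest, clarify)
  interpret Metric_space "Lp p" "Lp_dist p"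
    by (rule Metric_space_Lp[OF p])
  define L where "L = l (n - 3)"
  define e where "e = (1 / 2 ^ (n - 3) :: real)"
  define a where "a = 8 / 9 * e"
  \<comment> \<open>Chosen so that the number of cells 2^(L-1) is 32 r and the bound 2^(L-4) is 4 r;
    L \<ge> 9 keeps the subtraction exact.\<close>
  define r where "r = (2 ^ (L - 6) :: nat)"
  have e: "0 < e" and a: "0 \<le> a" and N: "0 < 32 * r"
    by (auto simp: e_def a_def r_def)
  define d where "d = L - 6"
  have d: "L = d + 6"
    using L9 by (simp add: d_def L_def)
  have Lr: "2 ^ (L - 1) = 32 * r" "2 ^ (L - 4) = 4 * r"
    by (simp_all add: r_def d power_add)
  define G where "G S = Lp_eq p `` {sign_wave (32 * r) a S}" for S
  have G: "G S \<in> Lp p" "sign_wave (32 * r) a S \<in> G S" for S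
    using Lp_class[OF sign_wave_Lp(3)[OF p a N]] by (auto simp: G_def)
  have GK: "G S \<in> Lp_modulus_class p l" for S
    using sign_wave_modulus[OF p l n L9, of S] Lp_modulus_class_iff[OF p G]
    unfolding L_def[symmetric] e_def[symmetric] a_def[symmetric] Lr by simp
  fix k and c :: "nat \<Rightarrow> (real \<Rightarrow> real) set"
  assume c: "\<forall>i<2 ^ k. c i \<in> Lp p"
    and K: "Lp_modulus_class p l \<subseteq> (\<Union>i<2 ^ k. mball (c i) (1 / 2 ^ n))"
  have "\<exists>i. i < 2 ^ k \<and> G S \<in> mball (c i) (1 / 2 ^ n)" for S
    using K GK[of S] by blast
  then obtain \<iota> where \<iota>: "\<And>S. \<iota> S < 2 ^ k" "\<And>S. G S \<in> mball (c (\<iota> S)) (1 / 2 ^ n)"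
    by metis
  define n' where "n' = n - 3"
  have n': "n = n' + 3"
    using n by (simp add: n'_def)
  have "4 * r \<le> k"
  proof (rule hamming_covering_bound[of r \<iota>])
    show "\<iota> S < 2 ^ k" for S
      by (rule \<iota>)
    fix S T assume S: "S \<subseteq> {..<32 * r}" "T \<subseteq> {..<32 * r}" "\<iota> S = \<iota> T"
    let ?D = "S - T \<union> (T - S)"
    have "c (\<iota> S) \<in> Lp p"
      using c \<iota>(1) by blast
    then have "Lp_dist p (G S) (G T) \<le> Lp_dist p (c (\<iota> S)) (G S) + Lp_dist p (c (\<iota> S)) (G T)"
      using triangle[OF G(1) _ G(1), of "c (\<iota> S)" S T] commute[of "G S" "c (\<iota> S)"] by simp
    also have "\<dots> < 1 / 2 ^ n + 1 / 2 ^ n"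
      using \<iota>(2)[of S] \<iota>(2)[of T] S(3) by (intro add_strict_mono) auto
    \<comment> \<open>Here e = 8 * 2^-n. With a = (8/9) e and 32 r cells, a distance below e / 4
      means fewer than 9 r differing signs.\<close>
    also have "\<dots> = e / 4"
      by (simp add: e_def n' power_add)
    finally have "Lp_dist p (G S) (G T) < e / 4" .
    then have "a * real (card ?D) / real (32 * r) < e / 4"
      using sign_wave_distance[OF p a N S(1,2)] Lp_dist_eq[OF p G(1) G(2) G(1) G(2), of S T] by simp
    then have "e * (8 / 9 * real (card ?D)) < e * (8 * real r)"
      using N by (simp add: a_def field_simps)
    then have "real (card ?D) < real (9 * r)"
      using e by simp
    then show "card ?D \<le> 9 * r"
      by linarith
  qed
  then show "enat (2 ^ (l (n - 3) - 4)) \<le> enat k"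
    by (simp add: L_def[symmetric] Lr)
qed

theorem theorem5p13:
  fixes p :: real
  assumes "1 \<le> p"
  shows "(\<forall>K \<subseteq> Lp p.
            relatively_compactin (Metric_space.mtopology (Lp p) (Lp_dist p)) K \<longleftrightarrow>
            (\<exists>l. K \<subseteq> Lp_modulus_class p l)) \<and>
         (\<exists>P. second_order_poly P \<and>
            (\<forall>l n. metric_entropy (Lp p) (Lp_dist p) (Lp_modulus_class p l) n
                     \<le> enat (2 ^ P l n))) \<and>
         (\<forall>l n. modulus_growth l \<longrightarrow> n \<ge> 3 \<longrightarrow> l (n - 3) \<ge> 9 \<longrightarrow>
            enat (2 ^ (l (n - 3) - 4) - 1)
              \<le> metric_entropy (Lp p) (Lp_dist p) (Lp_modulus_class p l) n)"
proof (intro conjI allI impI)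
  show "relatively_compactin (Metric_space.mtopology (Lp p) (Lp_dist p)) K \<longleftrightarrow>
      (\<exists>l. K \<subseteq> Lp_modulus_class p l)" if "K \<subseteq> Lp p" for K
    by (rule relatively_compact_iff_modulus[OF assms that])
  show "\<exists>P. second_order_poly P \<and>
      (\<forall>l n. metric_entropy (Lp p) (Lp_dist p) (Lp_modulus_class p l) n \<le> enat (2 ^ P l n))"
    by (rule metric_entropy_upper[OF assms])
  fix l :: "nat \<Rightarrow> nat" and n :: nat
  assume "modulus_growth l" "3 \<le> n" "9 \<le> l (n - 3)"
  from metric_entropy_lower[OF assms this]
  show "enat (2 ^ (l (n - 3) - 4) - 1)
      \<le> metric_entropy (Lp p) (Lp_dist p) (Lp_modulus_class p l) n"
    by (rule order_trans[rotated]) simp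
qed

end
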